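(* Let $\mathring{\Phi}$ be an irreducible reduced finite root system of rank $n\ge2$ with fundamental system $\{\alpha_1,\dots,\alpha_n\}$, let $k\ge1$, and let $\Phi=\{\alpha\oplus\mathbb{Z}^k:\alpha\in\mathring{\Phi}\cup\{0\}\}$ be the associated untwisted affine reflection system of toroidal type. The maximal closed subroot systems of $\Phi$ with full gradient are in one-to-one correspondence with $$\{(q,(b_{\alpha_i}),U): q\text{ is a prime number},\ (b_{\alpha_i})\in[0,q-1]^n \text{ is a tuple of integers},\ U\in\mathbb{H}_q\}.$$ In particular, the maximal closed subroot system associated to a triple $(q,(b_{\alpha_i}),U)$ is given by $$\{\alpha\oplus (b_\alpha e_\ell+\mathbb{Z}u_1+\cdots+\mathbb{Z}u_k):\alpha\in\mathring{\Phi}\},$$ where $u_1,\dots,u_k$ are the rows of $U$, $\ell$ is the unique integer such that $u_\ell=qe_\ell$ ($e_\ell$ being the $\ell$-th unit vector), and $b_\alpha=\sum_i a_ib_{\alpha_i}$ for $\alpha=\sum_i a_i\alpha_i$.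
   Context: A finite root system $\mathring{\Phi}$ spans a Euclidean space $V$ with inner product $(\cdot,\cdot)$; it is reduced if $\mathbb{R}\alpha\cap\mathring{\Phi}=\{\pm\alpha\}$ for all $\alpha$. Put $\alpha^\vee=2\alpha/(\alpha,\alpha)$, $s_\alpha(v)=v-(v,\alpha^\vee)\alpha$. For $S\subseteq\mathbb{R}^k$, $\alpha\oplus S=\{\alpha\oplus y:y\in S\}\subset V\oplus\mathbb{R}^k$, and displayed sets of such expressions denote their unions. The real roots of $\Phi$ are $\Phi^{\mathrm{re}}=\{\alpha\oplus y:\alpha\in\mathring{\Phi},\ y\in\mathbb{Z}^k\}$, and the reflections are $s_{\alpha\oplus y}(\beta\oplus z)=s_\alpha(\beta)\oplus(z-(\beta,\alpha^\vee)y)$. A proper non-empty subset $\Psi\subsetneq\Phi^{\mathrm{re}}$ is a subroot system if $s_a(b)\in\Psi$ for all $a,b\in\Psi$; it is closed if $a,b\in\Psi$ and $a+b\in\Phi^{\mathrm{re}}$ imply $a+b\in\Psi$; it is a maximal closed subroot system if it is a closed subroot system and there is no closed subroot system $\Psi'$ with $\Psi\subsetneq\Psi'\subsetneq\Phi^{\mathrm{re}}$. Its gradient is $\mathrm{Gr}(\Psi)=\{\alpha\in\mathring{\Phi}:\exists y,\ \alpha\oplus y\in\Psi\}$, and the gradient is full if $\mathrm{Gr}(\Psi)=\mathring{\Phi}$. $\mathbb{H}_q$ is the set of $(k\times k)$ integer matrices in Hermite normal form with determinant $q$. Hermite normal form means: the matrix is upper triangular; the first nonzero entry from the left (pivot)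 of a nonzero row is strictly to the right of the pivot of the row above it and is positive; all zero rows are at the bottom, the entries below pivots are zero, and the entries above pivots are nonnegative and strictly smaller than the pivot. *)

theory Defs
  imports "HOL-Analysis.Analysis" "HOL-Computational_Algebra.Primes"
begin

section \<open>Finite root systems\<close>

definition coroot :: "'a::euclidean_space \<Rightarrow> 'a" where
  "coroot \<alpha> = (2 / (\<alpha> \<bullet> \<alpha>)) *\<^sub>R \<alpha>"

definition reflection :: "'a::euclidean_space \<Rightarrow> 'a \<Rightarrow> 'a" where
  "reflection \<alpha> v = v - (v \<bullet> coroot \<alpha>) *\<^sub>R \<alpha>"

text \<open>Finite root systems are crystallographic; since \<open>R\<close> spans the ambient space, its rank is
  the dimension of the type.\<close>

definition finite_root_system :: "'a::euclidean_space set \<Rightarrow> bool" where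
  "finite_root_system R \<longleftrightarrow>
     finite R \<and> 0 \<notin> R \<and> span R = UNIV \<and>
     (\<forall>\<alpha>\<in>R. reflection \<alpha> ` R = R) \<and>
     (\<forall>\<alpha>\<in>R. \<forall>\<beta>\<in>R. \<beta> \<bullet> coroot \<alpha> \<in> \<int>)"

definition reduced_root_system :: "'a::euclidean_space set \<Rightarrow> bool" where
  "reduced_root_system R \<longleftrightarrow> (\<forall>\<alpha>\<in>R. range (\<lambda>c::real. c *\<^sub>R \<alpha>) \<inter> R = {\<alpha>, - \<alpha>})"

definition irreducible_root_system :: "'a::euclidean_space set \<Rightarrow> bool" where
  "irreducible_root_system R \<longleftrightarrow>
     R \<noteq> {} \<and>
     (\<nexists>A B. A \<noteq> {} \<and> B \<noteq> {} \<and> A \<inter> B = {} \<and> A \<union> B = R \<and> (\<forall>\<alpha>\<in>A. \<forall>\<beta>\<in>B. \<alpha> \<bullet> \<beta> = 0))"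

definition fundamental_system :: "'a::euclidean_space set \<Rightarrow> 'a set \<Rightarrow> bool" where
  "fundamental_system R \<Delta> \<longleftrightarrow>
     \<Delta> \<subseteq> R \<and> independent \<Delta> \<and> span \<Delta> = UNIV \<and>
     (\<forall>\<alpha>\<in>R. \<exists>c :: 'a \<Rightarrow> int. \<alpha> = (\<Sum>\<delta>\<in>\<Delta>. of_int (c \<delta>) *\<^sub>R \<delta>) \<and>
        ((\<forall>\<delta>\<in>\<Delta>. 0 \<le> c \<delta>) \<or> (\<forall>\<delta>\<in>\<Delta>. c \<delta> \<le> 0)))"

section \<open>Untwisted affine reflection systems of toroidal type\<close>

text \<open>The element \<open>\<alpha> \<oplus> y\<close> is the pair \<open>(\<alpha>, y)\<close>. Only the real roots of the affine reflection
  system occur below, and they are determined by the finite root system \<open>R\<close>.\<close>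

definition integer_lattice :: "(real^'k) set" where
  "integer_lattice = {y. \<forall>i. y $ i \<in> \<int>}"

definition real_roots :: "'a::euclidean_space set \<Rightarrow> ('a \<times> (real^'k)) set" where
  "real_roots R = R \<times> integer_lattice"

definition affine_reflection ::
  "'a::euclidean_space \<times> (real^'k) \<Rightarrow> 'a \<times> (real^'k) \<Rightarrow> 'a \<times> (real^'k)" where
  "affine_reflection a b =
     (reflection (fst a) (fst b), snd b - (fst b \<bullet> coroot (fst a)) *\<^sub>R snd a)"

definition subroot_system :: "'a::euclidean_space set \<Rightarrow> ('a \<times> (real^'k)) set \<Rightarrow> bool" where
  "subroot_system R \<Psi> \<longleftrightarrow>
     \<Psi> \<noteq> {} \<and> \<Psi> \<subset> real_roots R \<and> (\<forall>a\<in>\<Psi>. \<forall>b\<in>\<Psi>. affine_reflection a b \<in> \<Psi>)"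

definition closed_subroot_system :: "'a::euclidean_space set \<Rightarrow> ('a \<times> (real^'k)) set \<Rightarrow> bool" where
  "closed_subroot_system R \<Psi> \<longleftrightarrow>
     subroot_system R \<Psi> \<and> (\<forall>a\<in>\<Psi>. \<forall>b\<in>\<Psi>. a + b \<in> real_roots R \<longrightarrow> a + b \<in> \<Psi>)"

definition maximal_closed_subroot_system ::
  "'a::euclidean_space set \<Rightarrow> ('a \<times> (real^'k)) set \<Rightarrow> bool" where
  "maximal_closed_subroot_system R \<Psi> \<longleftrightarrow>
     closed_subroot_system R \<Psi> \<and>
     (\<nexists>\<Psi>'. closed_subroot_system R \<Psi>' \<and> \<Psi> \<subset> \<Psi>' \<and> \<Psi>' \<subset> real_roots R)"

definition gradient :: "'a::euclidean_space set \<Rightarrow> ('a \<times> (real^'k)) set \<Rightarrow> 'a set" where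
  "gradient R \<Psi> = {\<alpha>\<in>R. \<exists>y. (\<alpha>, y) \<in> \<Psi>}"

section \<open>Hermite normal form\<close>

text \<open>Rows and columns are indexed by a finite linearly ordered type. Every finite linear order is
  a well-order, so the sort \<open>{finite, wellorder}\<close> (as in \<open>det_upperdiagonal\<close>) is no
  restriction; the size \<open>k \<ge> 1\<close> is the cardinality of the index type.\<close>

definition pivot :: "int^'k::{finite,wellorder}^'k::{finite,wellorder} \<Rightarrow> 'k \<Rightarrow> 'k" where
  "pivot U i = (LEAST j. U $ i $ j \<noteq> 0)"

definition hermite_normal_form :: "int^'k::{finite,wellorder}^'k::{finite,wellorder} \<Rightarrow> bool" where
  "hermite_normal_form U \<longleftrightarrow>
     (\<forall>i j. j < i \<longrightarrow> U $ i $ j = 0) \<and>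
     (\<forall>i i'. i < i' \<and> row i U = 0 \<longrightarrow> row i' U = 0) \<and>
     (\<forall>i i'. i < i' \<and> row i U \<noteq> 0 \<and> row i' U \<noteq> 0 \<longrightarrow> pivot U i < pivot U i') \<and>
     (\<forall>i. row i U \<noteq> 0 \<longrightarrow>
        0 < U $ i $ pivot U i \<and>
        (\<forall>i'>i. U $ i' $ pivot U i = 0) \<and>
        (\<forall>i'<i. 0 \<le> U $ i' $ pivot U i \<and> U $ i' $ pivot U i < U $ i $ pivot U i))"

definition hermite_matrices :: "nat \<Rightarrow> (int^'k::{finite,wellorder}^'k::{finite,wellorder}) set" where
  "hermite_matrices q = {U. hermite_normal_form U \<and> det U = int q}"

section \<open>The closed subroot system attached to a triple\<close>

definition row_lattice :: "int^'k::{finite,wellorder}^'k::{finite,wellorder} \<Rightarrow> (real^'k::{finite,wellorder}) set" where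
  "row_lattice U = {\<Sum>i\<in>UNIV. of_int (c i) *\<^sub>R (\<chi> j. of_int (U $ i $ j)) | c :: 'k \<Rightarrow> int. True}"

definition scaled_row :: "nat \<Rightarrow> int^'k::{finite,wellorder}^'k::{finite,wellorder} \<Rightarrow> 'k \<Rightarrow> bool" where
  "scaled_row q U l \<longleftrightarrow> row l U = int q *s axis l 1"

text \<open>A tuple \<open>(b\<^sub>\<delta>)\<close> is a function on the fundamental system \<open>\<Delta>\<close>, extended linearly;
  \<open>representation \<Delta> \<alpha>\<close> gives the coordinates of \<open>\<alpha>\<close> in the basis \<open>\<Delta>\<close>.\<close>

definition linear_extension :: "'a::euclidean_space set \<Rightarrow> ('a \<Rightarrow> int) \<Rightarrow> 'a \<Rightarrow> real" where
  "linear_extension \<Delta> b \<alpha> = (\<Sum>\<delta>\<in>\<Delta>. representation \<Delta> \<alpha> \<delta> * of_int (b \<delta>))"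

definition triples ::
  "'a::euclidean_space set \<Rightarrow> (nat \<times> ('a \<Rightarrow> int) \<times> (int^'k::{finite,wellorder}^'k::{finite,wellorder})) set" where
  "triples \<Delta> = {(q, b, U). prime q \<and> b \<in> \<Delta> \<rightarrow>\<^sub>E {0..int q - 1} \<and> U \<in> hermite_matrices q}"

definition associated_system ::
  "'a::euclidean_space set \<Rightarrow> 'a set \<Rightarrow>
   nat \<times> ('a \<Rightarrow> int) \<times> (int^'k::{finite,wellorder}^'k::{finite,wellorder}) \<Rightarrow> ('a \<times> (real^'k::{finite,wellorder})) set" where
  "associated_system R \<Delta> = (\<lambda>(q, b, U).
     {(\<alpha>, linear_extension \<Delta> b \<alpha> *\<^sub>R axis (THE l. scaled_row q U l) 1 + y) | \<alpha> y.
        \<alpha> \<in> R \<and> y \<in> row_lattice U})"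

end

theory Submission
  imports Defs
begin

text \<open>Choose one element \<open>P \<delta>\<close> in the fibre of \<open>\<Psi>\<close> over each simple root and extend \<open>P\<close> linearly.
  Closedness of \<open>\<Psi>\<close> forces the translated fibres over all roots to be one and the same subgroup \<open>L\<close> of
  the integer lattice, so \<open>\<Psi>\<close> is a union of cosets \<open>P \<alpha> + L\<close>, and \<open>\<Psi>\<close> is maximal iff \<open>L\<close> is a maximal
  subgroup. For a maximal subgroup \<open>L\<close> let \<open>l\<close> be the last index with \<open>e\<^sub>l \<notin> L\<close>. Then \<open>L\<close> and
  \<open>e\<^sub>l\<close> generate the lattice and \<open>{n. n e\<^sub>l \<in> L}\<close> is generated by a prime \<open>q\<close>; reducing the other
  unit vectors modulo \<open>L\<close> to multiples of \<open>e\<^sub>l\<close> in the range \<open>[0, q - 1]\<close> gives the Hermite basis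
  of \<open>L\<close>, and reducing the values \<open>P \<delta>\<close> in the same way gives the tuple \<open>(b\<^sub>\<delta>)\<close>.\<close>

section \<open>Finite root systems\<close>

lemma root_uminus:
  assumes "finite_root_system R" "\<alpha> \<in> R"
  shows "- \<alpha> \<in> R"
proof -
  have "\<alpha> \<noteq> 0" using assms unfolding finite_root_system_def by auto
  then have "reflection \<alpha> \<alpha> = - \<alpha>"
    by (simp add: reflection_def coroot_def scaleR_2)
  then show ?thesis using assms unfolding finite_root_system_def by force
qed

text \<open>Both Cartan integers are positive. If one of them is 1, a reflection produces the
  difference up to sign; if both were at least 2, the squared norm of
  \<open>\<alpha> - \<beta>\<close> would be at most 0.\<close>

lemma root_diff:
  assumes R: "finite_root_system R" and \<alpha>: "\<alpha> \<in> R" and \<beta>: "\<beta> \<in> R"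
    and pos: "\<alpha> \<bullet> \<beta> > 0" and neq: "\<alpha> \<noteq> \<beta>"
  shows "\<alpha> - \<beta> \<in> R"
proof -
  have pa: "\<alpha> \<bullet> \<alpha> > 0" and pb: "\<beta> \<bullet> \<beta> > 0"
    using pos by auto
  have refl: "reflection \<alpha> \<beta> \<in> R" "reflection \<beta> \<alpha> \<in> R"
    using R \<alpha> \<beta> unfolding finite_root_system_def by blast+
  have "\<alpha> \<bullet> coroot \<beta> \<in> \<int>" "\<beta> \<bullet> coroot \<alpha> \<in> \<int>"
    using R \<alpha> \<beta> unfolding finite_root_system_def by blast+
  then obtain m n :: int where m: "\<alpha> \<bullet> coroot \<beta> = m" and n: "\<beta> \<bullet> coroot \<alpha> = n"
    by (metis Ints_cases)
  have m': "2 * (\<alpha> \<bullet> \<beta>) = m * (\<beta> \<bullet> \<beta>)" and n': "2 * (\<alpha> \<bullet> \<beta>) = n * (\<alpha> \<bullet> \<alpha>)"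
    using m n pa pb by (auto simp: coroot_def field_simps inner_commute)
  have "m > 0" "n > 0"
    using m' n' pa pb pos by (smt (verit) mult_nonpos_nonneg of_int_le_0_iff)+
  then consider "m = 1" | "n = 1" | "m \<ge> 2" "n \<ge> 2" by linarith
  then show ?thesis
  proof cases
    case 1
    then show ?thesis using refl(2) m by (simp add: reflection_def)
  next
    case 2
    then have "\<beta> - \<alpha> \<in> R" using refl(1) n by (simp add: reflection_def)
    then show ?thesis using root_uminus[OF R] by force
  next
    case 3
    have "2 * (\<beta> \<bullet> \<beta>) \<le> m * (\<beta> \<bullet> \<beta>)" "2 * (\<alpha> \<bullet> \<alpha>) \<le> n * (\<alpha> \<bullet> \<alpha>)"
      using 3 pa pb by (auto intro!: mult_right_mono)
    then have "(\<alpha> - \<beta>) \<bullet> (\<alpha> - \<beta>) \<le> 0"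
      using m' n' by (simp add: inner_diff inner_commute)
    then show ?thesis using neq by (metis inner_gt_zero_iff not_le right_minus_eq)
  qed
qed

lemma fundamental_system_finite:
  assumes "fundamental_system R \<Delta>"
  shows "finite \<Delta>"
  using assms independent_imp_finite unfolding fundamental_system_def by blast

text \<open>A positive root \<open>\<alpha>\<close> has positive inner product with some simple root \<open>\<delta>\<close> in its support,
  so \<open>\<alpha> - \<delta>\<close> is again a root unless \<open>\<alpha> = \<delta>\<close>; induct on the height.\<close>

lemma fundamental_system_generates:
  assumes R: "finite_root_system R" and \<Delta>: "fundamental_system R \<Delta>"
    and base: "\<Delta> \<subseteq> S" and neg: "\<And>\<alpha>. \<alpha> \<in> S \<Longrightarrow> - \<alpha> \<in> S"
    and add: "\<And>\<alpha> \<beta>. \<alpha> \<in> S \<Longrightarrow> \<beta> \<in> S \<Longrightarrow> \<alpha> + \<beta> \<in> R \<Longrightarrow> \<alpha> + \<beta> \<in> S"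
  shows "R \<subseteq> S"
proof -
  have fin: "finite \<Delta>" by (rule fundamental_system_finite[OF \<Delta>])
  have DR: "\<Delta> \<subseteq> R" using \<Delta> unfolding fundamental_system_def by blast
  have pos: "\<alpha> \<in> S"
    if "\<alpha> \<in> R" "\<alpha> = (\<Sum>\<delta>\<in>\<Delta>. of_int (c \<delta>) *\<^sub>R \<delta>)" "\<forall>\<delta>\<in>\<Delta>. 0 \<le> c \<delta>" for \<alpha> and c :: "'a \<Rightarrow> int"
    using that
  proof (induction "nat (\<Sum>\<delta>\<in>\<Delta>. c \<delta>)" arbitrary: \<alpha> c rule: less_induct)
    case less
    have "\<alpha> \<noteq> 0" using R less.prems(1) unfolding finite_root_system_def by auto
    then have "0 < \<alpha> \<bullet> \<alpha>" by simp
    also have "\<alpha> \<bullet> \<alpha> = (\<Sum>\<delta>\<in>\<Delta>. c \<delta> * (\<alpha> \<bullet> \<delta>))"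
      by (subst (2) less.prems(2)) (simp add: inner_sum_right)
    finally obtain \<delta> where \<delta>: "\<delta> \<in> \<Delta>" "0 < c \<delta> * (\<alpha> \<bullet> \<delta>)"
      by (meson not_le sum_nonpos)
    have cp: "c \<delta> > 0" and ip: "\<alpha> \<bullet> \<delta> > 0"
      using \<delta> less.prems(3) by (smt (verit, best) of_int_0_less_iff of_int_0_le_iff zero_less_mult_iff)+
    show ?case
    proof (cases "\<alpha> = \<delta>")
      case True
      then show ?thesis using \<delta> base by auto
    next
      case False
      define d where "d = c(\<delta> := c \<delta> - 1)"
      have r: "\<alpha> - \<delta> \<in> R"
        using root_diff[OF R less.prems(1) _ ip False] \<delta>(1) DR by blast
      have s: "sum c \<Delta> = c \<delta> + sum c (\<Delta> - {\<delta>})" "sum d \<Delta> = d \<delta> + sum d (\<Delta> - {\<delta>})"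
        using fin \<delta>(1) by (simp_all add: sum.remove)
      have "sum d (\<Delta> - {\<delta>}) = sum c (\<Delta> - {\<delta>})"
        by (rule sum.cong) (auto simp: d_def)
      moreover have "sum c (\<Delta> - {\<delta>}) \<ge> 0"
        using less.prems(3) by (intro sum_nonneg) auto
      ultimately have lt: "nat (sum d \<Delta>) < nat (sum c \<Delta>)"
        using s cp by (simp add: d_def)
      have "(\<Sum>x\<in>\<Delta>. of_int (d x) *\<^sub>R x) = (\<Sum>x\<in>\<Delta>. of_int (c x) *\<^sub>R x - (if x = \<delta> then x else 0))"
        by (rule sum.cong) (auto simp: d_def algebra_simps)
      also have "\<dots> = \<alpha> - \<delta>"
        using fin \<delta>(1) less.prems(2) by (simp add: sum_subtractf)
      finally have e: "\<alpha> - \<delta> = (\<Sum>x\<in>\<Delta>. of_int (d x) *\<^sub>R x)" ..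
      have "\<alpha> - \<delta> \<in> S"
        using less.hyps[OF lt r e] less.prems(3) cp by (auto simp: d_def)
      then show ?thesis using add[of "\<alpha> - \<delta>" \<delta>] \<delta>(1) base less.prems(1) by auto
    qed
  qed
  show ?thesis
  proof
    fix \<alpha> assume a: "\<alpha> \<in> R"
    then obtain c :: "'a \<Rightarrow> int" where c: "\<alpha> = (\<Sum>\<delta>\<in>\<Delta>. of_int (c \<delta>) *\<^sub>R \<delta>)"
      "(\<forall>\<delta>\<in>\<Delta>. 0 \<le> c \<delta>) \<or> (\<forall>\<delta>\<in>\<Delta>. c \<delta> \<le> 0)"
      using \<Delta> unfolding fundamental_system_def by blast
    from c(2) show "\<alpha> \<in> S"
    proof
      assume "\<forall>\<delta>\<in>\<Delta>. 0 \<le> c \<delta>"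
      then show ?thesis using pos a c(1) by blast
    next
      assume n: "\<forall>\<delta>\<in>\<Delta>. c \<delta> \<le> 0"
      have "- \<alpha> \<in> S"
        by (rule pos[of _ "\<lambda>x. - c x"]) (use n c(1) root_uminus[OF R a] in \<open>auto simp: sum_negf\<close>)
      then show ?thesis using neg by force
    qed
  qed
qed

text \<open>Otherwise a level set of \<open>f\<close> and its complement would split
  \<open>R\<close> into two non-empty orthogonal parts.\<close>

lemma irreducible_const:
  assumes "irreducible_root_system R" "\<alpha> \<in> R" "\<beta> \<in> R"
    and "\<And>\<alpha> \<beta>. \<alpha> \<in> R \<Longrightarrow> \<beta> \<in> R \<Longrightarrow> \<alpha> \<bullet> \<beta> \<noteq> 0 \<Longrightarrow> f \<alpha> = f \<beta>"
  shows "f \<alpha> = f \<beta>"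
proof (rule ccontr)
  assume neq: "f \<alpha> \<noteq> f \<beta>"
  let ?A = "{\<gamma>\<in>R. f \<gamma> = f \<alpha>}" and ?B = "{\<gamma>\<in>R. f \<gamma> \<noteq> f \<alpha>}"
  have "?A \<noteq> {}" "?B \<noteq> {}" "?A \<inter> ?B = {}" "?A \<union> ?B = R"
    using assms(2,3) neq by auto
  moreover have "\<gamma> \<bullet> \<gamma>' = 0" if "\<gamma> \<in> ?A" "\<gamma>' \<in> ?B" for \<gamma> \<gamma>'
    using assms(4)[of \<gamma> \<gamma>'] that by (cases "\<gamma> \<bullet> \<gamma>' = 0") auto
  ultimately have "\<exists>A B. A \<noteq> {} \<and> B \<noteq> {} \<and> A \<inter> B = {} \<and> A \<union> B = R \<and> (\<forall>\<alpha>\<in>A. \<forall>\<beta>\<in>B. \<alpha> \<bullet> \<beta> = 0)"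
    by (intro exI[of _ ?A] exI[of _ ?B] conjI ballI)
  then show False using assms(1) unfolding irreducible_root_system_def by blast
qed

text \<open>Without such a pair, \<open>root_diff\<close> makes two roots orthogonal unless they are
  equal or opposite. Irreducibility then leaves a single pair \<open>\<alpha>\<close>,
  \<open>- \<alpha>\<close>, which spans only a line; this is where rank at least 2 enters.\<close>

lemma irreducible_root_sum:
  fixes R :: "'a::euclidean_space set"
  assumes R: "finite_root_system R" and irr: "irreducible_root_system R" and dim: "DIM('a) \<ge> 2"
  obtains \<alpha> \<beta> where "\<alpha> \<in> R" "\<beta> \<in> R" "\<alpha> + \<beta> \<in> R"
proof -
  have neg: "\<And>\<alpha>. \<alpha> \<in> R \<Longrightarrow> - \<alpha> \<in> R" using root_uminus[OF R] .
  have "\<exists>\<alpha>\<in>R. \<exists>\<beta>\<in>R. \<alpha> + \<beta> \<in> R"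
  proof (rule ccontr)
    assume no: "\<not> ?thesis"
    have orth: "\<alpha> \<bullet> \<beta> = 0" if "\<alpha> \<in> R" "\<beta> \<in> R" "\<alpha> \<noteq> \<beta>" "\<alpha> \<noteq> - \<beta>" for \<alpha> \<beta>
    proof (rule ccontr)
      assume "\<alpha> \<bullet> \<beta> \<noteq> 0"
      then consider "\<alpha> \<bullet> \<beta> > 0" | "\<alpha> \<bullet> (- \<beta>) > 0" by fastforce
      then show False
      proof cases
        case 1
        then have "\<alpha> + (- \<beta>) \<in> R" using root_diff[OF R] that by auto
        then show False using no neg that by blast
      next
        case 2
        then have "\<alpha> - (- \<beta>) \<in> R" using root_diff[OF R] that neg by blast
        then show False using no that by auto
      qed
    qed
    obtain \<alpha> where \<alpha>: "\<alpha> \<in> R" using irr unfolding irreducible_root_system_def by blast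
    have "R \<subseteq> {\<alpha>, - \<alpha>}"
    proof
      fix \<beta> assume "\<beta> \<in> R"
      \<comment> \<open>The function shown to be constant is the truth value of membership in
        \<open>{\<alpha>, - \<alpha>}\<close>.\<close>
      then have "(\<alpha> \<in> {\<alpha>, - \<alpha>}) = (\<beta> \<in> {\<alpha>, - \<alpha>})"
        using irreducible_const[OF irr \<alpha>, of \<beta> "\<lambda>\<gamma>. \<gamma> \<in> {\<alpha>, - \<alpha>}"] orth neg \<alpha>
        by (smt (verit) inner_commute insert_iff minus_minus singletonD)
      then show "\<beta> \<in> {\<alpha>, - \<alpha>}" by simp
    qed
    moreover have "{\<alpha>, - \<alpha>} \<subseteq> span {\<alpha>}" by (auto intro: span_neg span_base)
    ultimately have "span R \<subseteq> span {\<alpha>}" by (meson order_trans span_minimal subspace_span)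
    then have "dim (UNIV :: 'a set) \<le> card {\<alpha>}"
      using R dim_le_card[of UNIV "{\<alpha>}"] unfolding finite_root_system_def by auto
    then show False using dim by (simp add: dim_UNIV)
  qed
  then show ?thesis using that by blast
qed

section \<open>Subgroups of the integer lattice\<close>

definition lattice_subgroup :: "(real^'k) set \<Rightarrow> bool" where
  "lattice_subgroup L \<longleftrightarrow> L \<subseteq> integer_lattice \<and> 0 \<in> L \<and> (\<forall>x\<in>L. \<forall>y\<in>L. x - y \<in> L)"

definition maximal_lattice_subgroup :: "(real^'k) set \<Rightarrow> bool" where
  "maximal_lattice_subgroup L \<longleftrightarrow> lattice_subgroup L \<and> L \<noteq> integer_lattice \<and>
     (\<forall>L'. lattice_subgroup L' \<and> L \<subset> L' \<longrightarrow> L' = integer_lattice)"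

lemma lattice_subgroup_diff: "lattice_subgroup L \<Longrightarrow> x \<in> L \<Longrightarrow> y \<in> L \<Longrightarrow> x - y \<in> L"
  unfolding lattice_subgroup_def by blast

lemma lattice_subgroup_uminus: "lattice_subgroup L \<Longrightarrow> x \<in> L \<Longrightarrow> - x \<in> L"
  using lattice_subgroup_diff[of L 0 x] by (simp add: lattice_subgroup_def)

lemma lattice_subgroup_add: "lattice_subgroup L \<Longrightarrow> x \<in> L \<Longrightarrow> y \<in> L \<Longrightarrow> x + y \<in> L"
  using lattice_subgroup_diff[of L x "- y"] lattice_subgroup_uminus[of L y] by simp

lemma lattice_subgroup_scale:
  assumes "lattice_subgroup L" "x \<in> L"
  shows "of_int n *\<^sub>R x \<in> L"
proof -
  have nat: "of_nat m *\<^sub>R x \<in> L" for m :: nat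
  proof (induction m)
    case 0
    then show ?case using assms unfolding lattice_subgroup_def by simp
  next
    case (Suc m)
    then show ?case using lattice_subgroup_add[OF assms(1) Suc assms(2)] by (simp add: algebra_simps)
  qed
  show ?thesis
    using nat[of "nat n"] lattice_subgroup_uminus[OF assms(1) nat[of "nat (- n)"]]
    by (cases "n \<ge> 0") auto
qed

lemma lattice_subgroup_sum:
  assumes "lattice_subgroup L" "\<And>i. i \<in> I \<Longrightarrow> f i \<in> L"
  shows "sum f I \<in> L"
  using assms(2)
proof (induction I rule: infinite_finite_induct)
  case (insert i I)
  then show ?case using lattice_subgroup_add[OF assms(1)] by auto
qed (use assms(1) in \<open>auto simp: lattice_subgroup_def\<close>)

lemma lattice_subgroup_integer_lattice: "lattice_subgroup integer_lattice"
  unfolding lattice_subgroup_def integer_lattice_def by auto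

lemmas integer_lattice_diff = lattice_subgroup_diff[OF lattice_subgroup_integer_lattice]
  and integer_lattice_add = lattice_subgroup_add[OF lattice_subgroup_integer_lattice]
  and integer_lattice_scale = lattice_subgroup_scale[OF lattice_subgroup_integer_lattice]
  and integer_lattice_sum = lattice_subgroup_sum[OF lattice_subgroup_integer_lattice]

lemma axis_mem_integer_lattice [simp]: "axis i 1 \<in> integer_lattice"
  unfolding integer_lattice_def by (auto simp: axis_def)

section \<open>Closed subroot systems with full gradient\<close>

text \<open>\<open>P\<close> picks a base point in each fibre and matters only modulo
  \<open>L\<close>. Leaving it arbitrary lets one system be described by several maps, which the
  surjectivity argument exploits.\<close>

definition coset_system :: "'a::euclidean_space set \<Rightarrow> ('a \<Rightarrow> real^'k) \<Rightarrow> (real^'k) set \<Rightarrow> ('a \<times> (real^'k)) set" where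
  "coset_system R P L = {(\<alpha>, P \<alpha> + y) | \<alpha> y. \<alpha> \<in> R \<and> y \<in> L}"

lemma mem_coset_system: "(\<alpha>, z) \<in> coset_system R P L \<longleftrightarrow> \<alpha> \<in> R \<and> z - P \<alpha> \<in> L"
  unfolding coset_system_def by (auto intro!: exI[of _ "z - P \<alpha>"])

text \<open>Points of one fibre differ by elements of the subgroup, whichever base point is used.
  The subgroup is therefore an invariant of the system even when \<open>P\<close> and
  \<open>P'\<close> differ.\<close>

lemma coset_system_inject:
  assumes L: "lattice_subgroup L" and L': "lattice_subgroup L'" and "R \<noteq> {}"
    and eq: "coset_system R P L = coset_system R P' L'"
  shows "L = L'"
proof -
  have sub: "L1 \<subseteq> L2"
    if L1: "lattice_subgroup L1" and L2: "lattice_subgroup L2"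
      and e: "coset_system R P1 L1 = coset_system R P2 L2" for L1 L2 P1 P2
  proof
    fix z assume z: "z \<in> L1"
    obtain \<alpha> where "\<alpha> \<in> R" using assms(3) by blast
    then have "(\<alpha>, P1 \<alpha>) \<in> coset_system R P1 L1" "(\<alpha>, P1 \<alpha> + z) \<in> coset_system R P1 L1"
      using z L1 unfolding mem_coset_system lattice_subgroup_def by simp_all
    then have "P1 \<alpha> - P2 \<alpha> \<in> L2" "P1 \<alpha> + z - P2 \<alpha> \<in> L2"
      unfolding e mem_coset_system by blast+
    from lattice_subgroup_diff[OF L2 this(2,1)]
    show "z \<in> L2" by simp
  qed
  show ?thesis using sub[OF L L' eq] sub[OF L' L eq[symmetric]] by blast
qed

lemma gradient_coset_system:
  assumes "lattice_subgroup L"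
  shows "gradient R (coset_system R P L) = R"
proof -
  have "(\<alpha>, P \<alpha>) \<in> coset_system R P L" if "\<alpha> \<in> R" for \<alpha>
    using that assms by (simp add: mem_coset_system lattice_subgroup_def)
  then show ?thesis unfolding gradient_def by blast
qed

lemma linear_integral_on_roots:
  assumes \<Delta>: "fundamental_system R \<Delta>" and P: "linear P"
    and int: "\<And>\<delta>. \<delta> \<in> \<Delta> \<Longrightarrow> P \<delta> \<in> integer_lattice" and \<alpha>: "\<alpha> \<in> R"
  shows "P \<alpha> \<in> integer_lattice"
proof -
  obtain c :: "'a \<Rightarrow> int" where c: "\<alpha> = (\<Sum>\<delta>\<in>\<Delta>. of_int (c \<delta>) *\<^sub>R \<delta>)"
    using \<Delta> \<alpha> unfolding fundamental_system_def by blast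
  have "P \<alpha> = (\<Sum>\<delta>\<in>\<Delta>. of_int (c \<delta>) *\<^sub>R P \<delta>)"
    using P c by (simp add: linear_sum linear_scale)
  also have "\<dots> \<in> integer_lattice"
    by (intro integer_lattice_sum integer_lattice_scale int)
  finally show ?thesis .
qed

text \<open>Because \<open>P\<close> is linear, reflections and sums of base points are again base
  points, so both closure conditions reduce to subgroup properties of \<open>L\<close>. Properness
  of \<open>L\<close> makes the system proper.\<close>

lemma closed_coset_system:
  assumes R: "finite_root_system R" "R \<noteq> {}" and P: "linear P"
    and int: "\<And>\<alpha>. \<alpha> \<in> R \<Longrightarrow> P \<alpha> \<in> integer_lattice"
    and L: "lattice_subgroup L" "L \<noteq> integer_lattice"
  shows "closed_subroot_system R (coset_system R P L)"
proof -
  have Lsub: "L \<subseteq> integer_lattice" and L0: "0 \<in> L" using L unfolding lattice_subgroup_def by auto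
  obtain \<alpha> where \<alpha>: "\<alpha> \<in> R" using R by blast
  obtain y where y: "y \<in> integer_lattice" "y \<notin> L" using L Lsub by blast
  have "coset_system R P L \<subseteq> real_roots R"
    using Lsub int integer_lattice_add unfolding coset_system_def real_roots_def by blast
  moreover have "(\<alpha>, P \<alpha> + y) \<in> real_roots R" "(\<alpha>, P \<alpha> + y) \<notin> coset_system R P L"
    using \<alpha> y int integer_lattice_add by (auto simp: real_roots_def mem_coset_system)
  ultimately have sub: "coset_system R P L \<subset> real_roots R" by blast
  have ne: "coset_system R P L \<noteq> {}" using \<alpha> L0 unfolding coset_system_def by blast
  have refl: "affine_reflection a b \<in> coset_system R P L"
    if a: "a \<in> coset_system R P L" and b: "b \<in> coset_system R P L" for a b
  proof -
    obtain \<alpha> y \<beta> z where [simp]: "a = (\<alpha>, y)" "b = (\<beta>, z)" by (metis surj_pair)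
    have m: "\<alpha> \<in> R" "y - P \<alpha> \<in> L" "\<beta> \<in> R" "z - P \<beta> \<in> L"
      using a b by (auto simp: mem_coset_system)
    have "\<beta> \<bullet> coroot \<alpha> \<in> \<int>" and r: "reflection \<alpha> \<beta> \<in> R"
      using R m unfolding finite_root_system_def by blast+
    then obtain n :: int where n: "\<beta> \<bullet> coroot \<alpha> = n" by (metis Ints_cases)
    \<comment> \<open>Integrality of the Cartan number \<open>n\<close> is what keeps the scaled
      difference inside \<open>L\<close>.\<close>
    have "z - n *\<^sub>R y - P (reflection \<alpha> \<beta>) = (z - P \<beta>) - n *\<^sub>R (y - P \<alpha>)"
      using P by (simp add: reflection_def n linear_diff linear_scale algebra_simps)
    also have "\<dots> \<in> L" by (intro lattice_subgroup_diff lattice_subgroup_scale L m)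
    finally show ?thesis using r by (simp add: affine_reflection_def mem_coset_system n)
  qed
  have "a + b \<in> coset_system R P L"
    if a: "a \<in> coset_system R P L" and b: "b \<in> coset_system R P L" and ab: "a + b \<in> real_roots R" for a b
  proof -
    obtain \<alpha> y \<beta> z where [simp]: "a = (\<alpha>, y)" "b = (\<beta>, z)" by (metis surj_pair)
    have m: "y - P \<alpha> \<in> L" "z - P \<beta> \<in> L"
      using a b by (auto simp: mem_coset_system)
    have "y + z - P (\<alpha> + \<beta>) = (y - P \<alpha>) + (z - P \<beta>)"
      using P by (simp add: linear_add)
    also have "\<dots> \<in> L" by (intro lattice_subgroup_add L m)
    finally show ?thesis using ab by (simp add: mem_coset_system real_roots_def)
  qed
  then show ?thesis
    using ne sub refl unfolding closed_subroot_system_def subroot_system_def by blast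
qed

section \<open>Fibres of a closed subroot system\<close>

lemma closed_subroot_uminus:
  assumes R: "finite_root_system R" and \<Psi>: "closed_subroot_system R \<Psi>"
    and "(\<alpha>, y) \<in> \<Psi>" "(\<alpha>, z) \<in> \<Psi>"
  shows "(- \<alpha>, z - 2 *\<^sub>R y) \<in> \<Psi>"
proof -
  have "affine_reflection (\<alpha>, y) (\<alpha>, z) \<in> \<Psi>" "\<alpha> \<in> R"
    using assms unfolding closed_subroot_system_def subroot_system_def real_roots_def by blast+
  moreover have "\<alpha> \<noteq> 0" using R \<open>\<alpha> \<in> R\<close> unfolding finite_root_system_def by auto
  ultimately show ?thesis
    by (simp add: affine_reflection_def reflection_def coroot_def scaleR_2)
qed

lemma closed_subroot_add:
  assumes "closed_subroot_system R \<Psi>" "(\<alpha>, y) \<in> \<Psi>" "(\<beta>, z) \<in> \<Psi>" "\<alpha> + \<beta> \<in> R"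
  shows "(\<alpha> + \<beta>, y + z) \<in> \<Psi>"
proof -
  have "y \<in> integer_lattice" "z \<in> integer_lattice"
    using assms unfolding closed_subroot_system_def subroot_system_def real_roots_def by blast+
  then have "(\<alpha>, y) + (\<beta>, z) \<in> real_roots R"
    using assms(4) integer_lattice_add by (auto simp: real_roots_def)
  then show ?thesis using assms unfolding closed_subroot_system_def by fastforce
qed

text \<open>After translating by \<open>P\<close>, every fibre \<open>Z \<alpha>\<close> contains \<open>0\<close>; then \<open>Z \<alpha> + Z \<beta> \<subseteq> Z (\<alpha> + \<beta>)\<close> and
  \<open>Z (- \<alpha>) = Z \<alpha>\<close> force the fibres of any two non-orthogonal roots to agree.\<close>

lemma closed_subroot_is_coset_system:
  fixes R :: "'a::euclidean_space set"
  assumes R: "finite_root_system R" and irr: "irreducible_root_system R" and dim: "DIM('a) \<ge> 2"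
    and \<Delta>: "fundamental_system R \<Delta>" and \<Psi>: "closed_subroot_system R \<Psi>"
    and P: "linear P" and P\<Delta>: "\<And>\<delta>. \<delta> \<in> \<Delta> \<Longrightarrow> (\<delta>, P \<delta>) \<in> \<Psi>"
  obtains L where "lattice_subgroup L" "L \<noteq> integer_lattice" "\<Psi> = coset_system R P L"
proof -
  have sub: "\<Psi> \<subset> real_roots R"
    using \<Psi> unfolding closed_subroot_system_def subroot_system_def by blast
  \<comment> \<open>Base points spread from the simple roots to all roots: the roots whose base
    point lies in \<open>\<Psi>\<close> are closed under negation and under sums that are
    roots.\<close>
  have "R \<subseteq> {\<alpha>\<in>R. (\<alpha>, P \<alpha>) \<in> \<Psi>}"
  proof (rule fundamental_system_generates[OF R \<Delta>])
    show "\<Delta> \<subseteq> {\<alpha>\<in>R. (\<alpha>, P \<alpha>) \<in> \<Psi>}" using P\<Delta> \<Delta> unfolding fundamental_system_def by blast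
    show "- \<alpha> \<in> {\<alpha>\<in>R. (\<alpha>, P \<alpha>) \<in> \<Psi>}" if "\<alpha> \<in> {\<alpha>\<in>R. (\<alpha>, P \<alpha>) \<in> \<Psi>}" for \<alpha>
      using closed_subroot_uminus[OF R \<Psi>, of \<alpha> "P \<alpha>" "P \<alpha>"] that root_uminus[OF R] P
      by (simp add: scaleR_2 linear_neg)
    show "\<alpha> + \<beta> \<in> {\<alpha>\<in>R. (\<alpha>, P \<alpha>) \<in> \<Psi>}"
      if "\<alpha> \<in> {\<alpha>\<in>R. (\<alpha>, P \<alpha>) \<in> \<Psi>}" "\<beta> \<in> {\<alpha>\<in>R. (\<alpha>, P \<alpha>) \<in> \<Psi>}" "\<alpha> + \<beta> \<in> R" for \<alpha> \<beta>
      using closed_subroot_add[OF \<Psi>, of \<alpha> "P \<alpha>" \<beta> "P \<beta>"] that P by (simp add: linear_add)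
  qed
  then have PR: "(\<alpha>, P \<alpha>) \<in> \<Psi>" if "\<alpha> \<in> R" for \<alpha> using that by blast
  have Pint: "P \<alpha> \<in> integer_lattice" if "\<alpha> \<in> R" for \<alpha>
    using PR[OF that] sub unfolding real_roots_def by blast
  define Z where "Z \<alpha> = {y. (\<alpha>, P \<alpha> + y) \<in> \<Psi>}" for \<alpha>
  have Z0: "0 \<in> Z \<alpha>" if "\<alpha> \<in> R" for \<alpha> using PR[OF that] by (simp add: Z_def)
  have Zadd: "y + z \<in> Z (\<alpha> + \<beta>)" if "y \<in> Z \<alpha>" "z \<in> Z \<beta>" "\<alpha> + \<beta> \<in> R" for y z \<alpha> \<beta>
    using closed_subroot_add[OF \<Psi>, of \<alpha> "P \<alpha> + y" \<beta> "P \<beta> + z"] that P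
    by (simp add: Z_def linear_add algebra_simps)
  \<comment> \<open>Reflecting the point with offset \<open>y\<close> in the base point over
    \<open>\<alpha>\<close> keeps the offset; reflecting it in itself changes the sign of the
    offset.\<close>
  have Zneg: "y \<in> Z (- \<alpha>)" "- y \<in> Z (- \<alpha>)" if "\<alpha> \<in> R" "y \<in> Z \<alpha>" for y \<alpha>
    using closed_subroot_uminus[OF R \<Psi>, of \<alpha> "P \<alpha>" "P \<alpha> + y"]
      closed_subroot_uminus[OF R \<Psi>, of \<alpha> "P \<alpha> + y" "P \<alpha> + y"] that P PR
    by (auto simp: Z_def linear_neg scaleR_2 algebra_simps)
  have Zneg_eq: "Z (- \<alpha>) = Z \<alpha>" if "\<alpha> \<in> R" for \<alpha>
    using Zneg(1)[of \<alpha>] Zneg(1)[of "- \<alpha>"] that root_uminus[OF R] by auto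
  have Zle: "Z \<alpha> \<subseteq> Z (\<alpha> + \<beta>)" if "\<beta> \<in> R" "\<alpha> + \<beta> \<in> R" for \<alpha> \<beta>
    using Zadd[of _ \<alpha> 0 \<beta>] Z0 that by auto
  \<comment> \<open>The reverse inclusion comes from adding \<open>- \<beta>\<close> to
    \<open>\<alpha> + \<beta>\<close>.\<close>
  have Zsum: "Z (\<alpha> + \<beta>) = Z \<alpha>" if "\<alpha> \<in> R" "\<beta> \<in> R" "\<alpha> + \<beta> \<in> R" for \<alpha> \<beta>
    using Zle[of \<beta> \<alpha>] Zle[of "- \<beta>" "\<alpha> + \<beta>"] that root_uminus[OF R] by auto
  have Zpos: "Z \<alpha> = Z \<beta>" if "\<alpha> \<in> R" "\<beta> \<in> R" "\<alpha> \<bullet> \<beta> > 0" for \<alpha> \<beta>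
  proof (cases "\<alpha> = \<beta>")
    case False
    then have r: "\<alpha> - \<beta> \<in> R" using root_diff[OF R] that by blast
    then show ?thesis using Zsum[of \<beta> "\<alpha> - \<beta>"] that by simp
  qed simp
  have Zconst: "Z \<alpha> = Z \<beta>" if "\<alpha> \<in> R" "\<beta> \<in> R" for \<alpha> \<beta>
  proof (rule irreducible_const[OF irr that])
    fix \<alpha> \<beta> assume ab: "\<alpha> \<in> R" "\<beta> \<in> R" "\<alpha> \<bullet> \<beta> \<noteq> 0"
    then consider "\<alpha> \<bullet> \<beta> > 0" | "\<alpha> \<bullet> (- \<beta>) > 0" by fastforce
    then show "Z \<alpha> = Z \<beta>"
      using Zpos ab Zneg_eq root_uminus[OF R] by cases metis+
  qed
  \<comment> \<open>A root that is itself a sum of two roots turns \<open>Zadd\<close> into closure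
    of the common fibre under addition.\<close>
  obtain \<alpha> \<beta> where ab: "\<alpha> \<in> R" "\<beta> \<in> R" "\<alpha> + \<beta> \<in> R"
    using irreducible_root_sum[OF R irr dim] by blast
  define L where "L = Z \<alpha>"
  have ZL: "Z \<gamma> = L" if "\<gamma> \<in> R" for \<gamma> using Zconst that ab unfolding L_def by blast
  have "y \<in> integer_lattice" if "y \<in> L" for y
  proof -
    have "P \<alpha> + y \<in> integer_lattice" using that sub unfolding L_def Z_def real_roots_def by blast
    then show ?thesis using integer_lattice_diff[OF _ Pint[OF ab(1)], of "P \<alpha> + y"] by simp
  qed
  moreover have "y - z \<in> L" if "y \<in> L" "z \<in> L" for y z
  proof -
    have "- z \<in> L" using Zneg(2)[OF ab(2), of z] ZL Zneg_eq that ab by auto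
    then show ?thesis using Zadd[of y \<alpha> "- z" \<beta>] ZL that ab by auto
  qed
  ultimately have sg: "lattice_subgroup L" using Z0 ab unfolding lattice_subgroup_def L_def by blast
  have eq: "\<Psi> = coset_system R P L"
  proof -
    have "(\<gamma>, z) \<in> \<Psi> \<longleftrightarrow> (\<gamma>, z) \<in> coset_system R P L" for \<gamma> z
    proof (cases "\<gamma> \<in> R")
      case True
      then have "(\<gamma>, z) \<in> \<Psi> \<longleftrightarrow> z - P \<gamma> \<in> Z \<gamma>" by (simp add: Z_def)
      then show ?thesis using True ZL by (simp add: mem_coset_system)
    next
      case False
      then show ?thesis using sub by (auto simp: mem_coset_system real_roots_def)
    qed
    then show ?thesis by auto
  qed
  have "L \<noteq> integer_lattice"
  proof
    assume "L = integer_lattice"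
    then have "(\<gamma>, y) \<in> \<Psi>" if "\<gamma> \<in> R" "y \<in> integer_lattice" for \<gamma> y
      using integer_lattice_diff[OF that(2) Pint[OF that(1)]] that(1) unfolding eq mem_coset_system by blast
    then have "real_roots R \<subseteq> \<Psi>" unfolding real_roots_def by blast
    then show False using sub by blast
  qed
  then show ?thesis using that sg eq by blast
qed

section \<open>Maximal systems and maximal subgroups\<close>

lemma coset_system_mono_iff:
  assumes "R \<noteq> {}"
  shows "coset_system R P L \<subseteq> coset_system R P L' \<longleftrightarrow> L \<subseteq> L'"
proof
  assume s: "coset_system R P L \<subseteq> coset_system R P L'"
  obtain \<alpha> where \<alpha>: "\<alpha> \<in> R" using assms by blast
  show "L \<subseteq> L'"
  proof
    fix y assume "y \<in> L"
    then have "(\<alpha>, P \<alpha> + y) \<in> coset_system R P L'" using \<alpha> s unfolding coset_system_def by blast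
    then show "y \<in> L'" by (simp add: mem_coset_system)
  qed
qed (auto simp: coset_system_def)

text \<open>A closed system above \<open>coset_system R P L\<close> contains the same base points
  over \<open>\<Delta>\<close>, so \<open>closed_subroot_is_coset_system\<close> describes it with
  the same \<open>P\<close> and a larger subgroup. Intermediate systems are thus intermediate
  subgroups.\<close>

lemma maximal_coset_system_iff:
  fixes R :: "'a::euclidean_space set"
  assumes R: "finite_root_system R" and irr: "irreducible_root_system R" and dim: "DIM('a) \<ge> 2"
    and \<Delta>: "fundamental_system R \<Delta>"
    and P: "linear P" and int: "\<And>\<delta>. \<delta> \<in> \<Delta> \<Longrightarrow> P \<delta> \<in> integer_lattice"
    and L: "lattice_subgroup L" "L \<noteq> integer_lattice"
  shows "maximal_closed_subroot_system R (coset_system R P L) \<longleftrightarrow> maximal_lattice_subgroup L"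
proof -
  have ne: "R \<noteq> {}" using irr unfolding irreducible_root_system_def by blast
  note mono = coset_system_mono_iff[OF ne]
  have clos: "closed_subroot_system R (coset_system R P L')"
    if "lattice_subgroup L'" "L' \<noteq> integer_lattice" for L'
    using closed_coset_system[OF R ne P _ that] linear_integral_on_roots[OF \<Delta> P int] by blast
  show ?thesis
  proof
    assume m: "maximal_closed_subroot_system R (coset_system R P L)"
    have "L' = integer_lattice" if "lattice_subgroup L'" "L \<subset> L'" for L'
    proof (rule ccontr)
      assume "L' \<noteq> integer_lattice"
      then have c: "closed_subroot_system R (coset_system R P L')" using clos that by blast
      then have "coset_system R P L' \<subset> real_roots R"
        unfolding closed_subroot_system_def subroot_system_def by blast
      then show False
        using m c mono[of P L L'] mono[of P L' L] that
        unfolding maximal_closed_subroot_system_def by blast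
    qed
    then show "maximal_lattice_subgroup L"
      using L unfolding maximal_lattice_subgroup_def by blast
  next
    assume m: "maximal_lattice_subgroup L"
    have False if c: "closed_subroot_system R \<Psi>'" and s: "coset_system R P L \<subset> \<Psi>'" for \<Psi>'
    proof -
      have "(\<delta>, P \<delta>) \<in> \<Psi>'" if "\<delta> \<in> \<Delta>" for \<delta>
      proof -
        have "(\<delta>, P \<delta>) \<in> coset_system R P L"
          using that \<Delta> L by (auto simp: mem_coset_system lattice_subgroup_def fundamental_system_def)
        then show ?thesis using s by blast
      qed
      then obtain L' where L': "lattice_subgroup L'" "L' \<noteq> integer_lattice" "\<Psi>' = coset_system R P L'"
        using closed_subroot_is_coset_system[OF R irr dim \<Delta> c P] by blast
      then have "L \<subset> L'" using s mono by blast
      then show False using m L' unfolding maximal_lattice_subgroup_def by blast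
    qed
    then show "maximal_closed_subroot_system R (coset_system R P L)"
      using clos[OF L] unfolding maximal_closed_subroot_system_def by blast
  qed
qed

section \<open>Maximal subgroups and Hermite normal forms of prime determinant\<close>

text \<open>The identity matrix with column \<open>l\<close> replaced by residues modulo
  \<open>q\<close> above the diagonal, \<open>q\<close> on it and zeros below. Having
  \<open>l\<close> as a parameter gives access to the only index where the matrix is not
  trivial.\<close>

definition prime_hermite :: "nat \<Rightarrow> 'k \<Rightarrow> int^'k::{finite,wellorder}^'k::{finite,wellorder} \<Rightarrow> bool" where
  "prime_hermite q l U \<longleftrightarrow>
     U $ l $ l = int q \<and> (\<forall>j. j \<noteq> l \<longrightarrow> U $ l $ j = 0) \<and>
     (\<forall>i. i \<noteq> l \<longrightarrow> U $ i $ i = 1) \<and>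
     (\<forall>i j. i \<noteq> l \<and> j \<noteq> l \<and> i \<noteq> j \<longrightarrow> U $ i $ j = 0) \<and>
     (\<forall>i>l. U $ i $ l = 0) \<and> (\<forall>i<l. 0 \<le> U $ i $ l \<and> U $ i $ l < int q)"

lemma pivot_upper_triangular:
  assumes "\<And>i j. j < i \<Longrightarrow> U $ i $ j = 0" "U $ i $ i \<noteq> 0"
  shows "pivot U i = i"
  unfolding pivot_def using assms by (intro Least_equality) (auto simp: not_less[symmetric])

text \<open>Some factor is divisible by \<open>q\<close>; cancelling \<open>q\<close> leaves a
  product equal to 1 in which the other factors are positive. It is meant for the diagonal of a
  Hermite matrix.\<close>

lemma prod_pos_eq_prime:
  fixes f :: "'b \<Rightarrow> int"
  assumes "finite I" "\<And>i. i \<in> I \<Longrightarrow> f i > 0" "prod f I = int q" "prime q"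
  obtains l where "l \<in> I" "f l = int q" "\<And>i. i \<in> I \<Longrightarrow> i \<noteq> l \<Longrightarrow> f i = 1"
proof -
  have "prime (int q)" using assms(4) by simp
  then obtain l where l: "l \<in> I" "int q dvd f l"
    using prime_dvd_prod_iff[OF assms(1), of "int q" f] assms(3) by auto
  then obtain t where t: "f l = int q * t" by auto
  have q: "int q > 0" using assms(4) prime_gt_0_nat by simp
  have "int q * (t * prod f (I - {l})) = int q"
    using assms(1,3) l(1) t by (simp add: prod.remove)
  then have one: "t * prod f (I - {l}) = 1" using q by simp
  have pos: "prod f (I - {l}) > 0" using assms(2) by (intro prod_pos) auto
  then have t1: "t = 1" using one by (metis pos_zmult_eq_1_iff mult.commute)
  have "f i = 1" if "i \<in> I" "i \<noteq> l" for i
  proof -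
    have "f i dvd prod f (I - {l})" using that assms(1) by (intro dvd_prodI) auto
    then have "f i dvd 1" using one t1 by simp
    then show ?thesis using assms(2)[OF that(1)] by simp
  qed
  then show ?thesis using that l(1) t t1 by simp
qed

text \<open>The determinant is the product of the diagonal, so no diagonal entry vanishes and every
  pivot is diagonal. One pivot is \<open>q\<close>, the others are 1, and an entry above a pivot 1
  is nonnegative and less than 1, hence 0.\<close>

lemma hermite_matrices_imp_prime_hermite:
  assumes q: "prime q" and U: "U \<in> hermite_matrices q"
  obtains l where "prime_hermite q l U"
proof -
  have h: "hermite_normal_form U" and d: "det U = int q"
    using U unfolding hermite_matrices_def by auto
  have up: "U $ i $ j = 0" if "j < i" for i j
    using h that unfolding hermite_normal_form_def by blast
  have pr: "(\<Prod>i\<in>UNIV. U $ i $ i) = int q" using det_upperdiagonal[of U] up d by simp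
  have nz: "U $ i $ i \<noteq> 0" for i
  proof
    assume "U $ i $ i = 0"
    then have "(\<Prod>i\<in>UNIV. U $ i $ i) = 0" by (auto intro: prod_zero)
    then show False using pr q by auto
  qed
  have piv: "pivot U i = i" for i using pivot_upper_triangular[of U i] up nz by blast
  have "row i U \<noteq> 0" for i using nz[of i] by (auto simp: row_def vec_eq_iff)
  then have pos: "0 < U $ i $ i" and above: "\<And>i'. i' < i \<Longrightarrow> 0 \<le> U $ i' $ i \<and> U $ i' $ i < U $ i $ i" for i
    using h piv unfolding hermite_normal_form_def by metis+
  obtain l where l: "U $ l $ l = int q" "\<And>i. i \<noteq> l \<Longrightarrow> U $ i $ i = 1"
    using prod_pos_eq_prime[of UNIV "\<lambda>i. U $ i $ i" q] pos pr q by auto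
  have off: "U $ i $ j = 0" if "j \<noteq> l" "i \<noteq> j" for i j
    using up[of j i] above[of i j] l(2)[of j] that by (cases "i < j") auto
  have "prime_hermite q l U"
    unfolding prime_hermite_def using l off up above[of _ l] by auto
  then show ?thesis by (rule that)
qed

lemma prime_hermite_imp_hermite_matrices:
  assumes q: "prime q" and U: "prime_hermite q l U"
  shows "U \<in> hermite_matrices q"
proof -
  have q0: "int q > 0" using q prime_gt_0_nat by simp
  have up: "U $ i $ j = 0" if "j < i" for i j
    using U that unfolding prime_hermite_def by (metis less_irrefl)
  have pos: "U $ i $ i > 0" for i
    using U q0 unfolding prime_hermite_def by (cases "i = l") auto
  have piv: "pivot U i = i" for i using pivot_upper_triangular[of U i] up pos by (metis less_irrefl)
  have above: "0 \<le> U $ i' $ i \<and> U $ i' $ i < U $ i $ i" if "i' < i" for i i'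
  proof (cases "i = l")
    case True
    then show ?thesis using U that unfolding prime_hermite_def by auto
  next
    case False
    then show ?thesis using U that pos[of i] unfolding prime_hermite_def by (cases "i' = l") auto
  qed
  have row: "row i U \<noteq> 0" for i using pos[of i] by (auto simp: row_def vec_eq_iff intro!: exI[of _ i])
  have "(\<Prod>i\<in>UNIV. U $ i $ i) = U $ l $ l * (\<Prod>i\<in>UNIV - {l}. U $ i $ i)"
    by (simp add: prod.remove)
  also have "\<dots> = int q" using U unfolding prime_hermite_def by simp
  finally have "det U = int q" using det_upperdiagonal[of U] up by simp
  moreover have "hermite_normal_form U"
    unfolding hermite_normal_form_def using up pos piv above row by auto
  ultimately show ?thesis unfolding hermite_matrices_def by blast
qed

text \<open>This justifies the definite description in \<open>associated_system\<close>: every other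
  row has diagonal entry 1, which is not a prime.\<close>

lemma prime_hermite_scaled_row:
  assumes q: "prime q" and U: "prime_hermite q l U"
  shows "scaled_row q U i \<longleftrightarrow> i = l"
proof
  assume "i = l"
  then show "scaled_row q U i"
    using U unfolding scaled_row_def prime_hermite_def
    by (auto simp: row_def vec_eq_iff axis_def)
next
  assume "scaled_row q U i"
  then have "U $ i $ i = int q"
    unfolding scaled_row_def by (auto simp: row_def vec_eq_iff axis_def)
  then show "i = l" using U prime_gt_1_nat[OF q] unfolding prime_hermite_def by fastforce
qed

text \<open>The row lattice of a matrix of this shape is the kernel of this functional modulo \<open>q\<close>.\<close>

definition hermite_functional :: "int^'k^'k \<Rightarrow> 'k \<Rightarrow> real^'k \<Rightarrow> real" where
  "hermite_functional U l y = y $ l - (\<Sum>i\<in>UNIV - {l}. of_int (U $ i $ l) * y $ i)"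

lemma hermite_functional_diff:
  "hermite_functional U l (x - y) = hermite_functional U l x - hermite_functional U l y"
  unfolding hermite_functional_def by (simp add: algebra_simps sum_subtractf)

lemma hermite_functional_scale:
  "hermite_functional U l (t *\<^sub>R y) = t * hermite_functional U l y"
  unfolding hermite_functional_def by (simp add: algebra_simps sum_distrib_left)

lemma hermite_functional_axis:
  "hermite_functional U l (axis i 1) = (if i = l then 1 else - of_int (U $ i $ l))"
  unfolding hermite_functional_def by (auto simp: axis_def if_distrib sum.delta cong: if_cong)

lemma hermite_functional_Ints:
  assumes "y \<in> integer_lattice"
  shows "hermite_functional U l y \<in> \<int>"
  using assms unfolding hermite_functional_def integer_lattice_def by (auto intro!: Ints_diff Ints_sum Ints_mult)

text \<open>Away from \<open>l\<close> the coordinates of a combination are its coefficients, so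
  membership in the row lattice imposes a single congruence, in coordinate \<open>l\<close>.\<close>

lemma prime_hermite_combination:
  assumes U: "prime_hermite q l U"
  shows "(\<Sum>i\<in>UNIV. of_int (c i) *\<^sub>R (\<chi> j. of_int (U $ i $ j))) $ j =
    (if j = l then real q * of_int (c l) + (\<Sum>i\<in>UNIV - {l}. of_int (U $ i $ l) * of_int (c i)) else (of_int (c j) :: real))"
proof (cases "j = l")
  case True
  then show ?thesis
    using U unfolding prime_hermite_def by (simp add: sum.remove[of UNIV l] mult.commute)
next
  case False
  then have Uij: "U $ i $ j = (if i = j then 1 else 0)" for i
    using U unfolding prime_hermite_def by metis
  have "(\<Sum>i\<in>UNIV. real_of_int (c i) * of_int (U $ i $ j)) = (\<Sum>i\<in>UNIV. if i = j then of_int (c j) else 0)"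
    by (rule sum.cong) (simp_all add: Uij)
  then show ?thesis using False by simp
qed

lemma mem_row_lattice:
  assumes U: "prime_hermite q l U"
  shows "y \<in> row_lattice U \<longleftrightarrow>
    y \<in> integer_lattice \<and> (\<exists>m::int. hermite_functional U l y = real q * of_int m)"
proof
  assume "y \<in> row_lattice U"
  then obtain c :: "'a \<Rightarrow> int" where c: "y = (\<Sum>i\<in>UNIV. of_int (c i) *\<^sub>R (\<chi> j. of_int (U $ i $ j)))"
    unfolding row_lattice_def by blast
  note yj = prime_hermite_combination[OF U, of c, folded c]
  have "y $ j \<in> \<int>" for j unfolding yj by (auto intro!: Ints_add Ints_sum Ints_mult)
  moreover have "hermite_functional U l y = real q * of_int (c l)"
    unfolding hermite_functional_def yj by simp
  ultimately show "y \<in> integer_lattice \<and> (\<exists>m::int. hermite_functional U l y = real q * of_int m)"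
    unfolding integer_lattice_def by blast
next
  assume y: "y \<in> integer_lattice \<and> (\<exists>m::int. hermite_functional U l y = real q * of_int m)"
  then obtain m :: int where m: "hermite_functional U l y = real q * of_int m" by blast
  \<comment> \<open>The coefficients away from \<open>l\<close> are forced to be the coordinates of
    \<open>y\<close>; the one at \<open>l\<close> is the quotient of the functional by
    \<open>q\<close>.\<close>
  define c where "c i = (if i = l then m else \<lfloor>y $ i\<rfloor>)" for i
  have fl: "of_int \<lfloor>y $ i\<rfloor> = y $ i" for i using y unfolding integer_lattice_def by simp
  have "y = (\<Sum>i\<in>UNIV. of_int (c i) *\<^sub>R (\<chi> j. of_int (U $ i $ j)))"
    unfolding vec_eq_iff prime_hermite_combination[OF U]
    using m by (simp add: c_def fl hermite_functional_def del: of_int_floor_cancel)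
  then show "y \<in> row_lattice U" unfolding row_lattice_def by blast
qed

lemma lattice_subgroup_row_lattice:
  assumes U: "prime_hermite q l U"
  shows "lattice_subgroup (row_lattice U)"
proof -
  have "x - y \<in> row_lattice U" if xy: "x \<in> row_lattice U" "y \<in> row_lattice U" for x y
  proof -
    obtain m n :: int where "hermite_functional U l x = real q * of_int m" "hermite_functional U l y = real q * of_int n"
      using xy mem_row_lattice[OF U] by blast
    then have "hermite_functional U l (x - y) = real q * of_int (m - n)"
      by (simp add: hermite_functional_diff algebra_simps)
    then show ?thesis using xy mem_row_lattice[OF U] integer_lattice_diff by blast
  qed
  moreover have "0 \<in> row_lattice U"
    using hermite_functional_scale[of U l 0 0]
    by (auto simp: mem_row_lattice[OF U] integer_lattice_def intro: exI[of _ 0])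
  ultimately show ?thesis
    using mem_row_lattice[OF U] unfolding lattice_subgroup_def by blast
qed

section \<open>Residues modulo a row lattice\<close>

lemma real_eq_of_nat_mult_iff: "(\<exists>m::int. real_of_int n = real q * of_int m) \<longleftrightarrow> int q dvd n"
proof -
  have "real_of_int n = real q * of_int m \<longleftrightarrow> n = int q * m" for m
    by (metis of_int_eq_iff of_int_mult of_int_of_nat_eq)
  then show ?thesis unfolding dvd_def by blast
qed

text \<open>Evaluate the functional, which is 1 on \<open>axis l 1\<close> and minus the entry in
  column \<open>l\<close> on the other unit vectors. From these memberships \<open>l\<close>,
  \<open>q\<close>, \<open>U\<close> and the tuple \<open>b\<close> are later recovered.\<close>

lemma axis_mem_row_lattice:
  assumes U: "prime_hermite q l U"
  shows "axis i 1 + of_int n *\<^sub>R axis l 1 \<in> row_lattice U \<longleftrightarrow>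
      int q dvd (if i = l then n + 1 else n - U $ i $ l)"
    and "of_int n *\<^sub>R axis l 1 \<in> row_lattice U \<longleftrightarrow> int q dvd n"
proof -
  have "hermite_functional U l (axis i 1 + of_int n *\<^sub>R axis l 1) =
     of_int (if i = l then n + 1 else n - U $ i $ l)"
    using hermite_functional_diff[of U l "axis i 1" "of_int (- n) *\<^sub>R axis l 1"]
      hermite_functional_scale[of U l "of_int (- n)" "axis l 1"]
    by (auto simp: hermite_functional_axis)
  moreover have "axis i 1 + of_int n *\<^sub>R axis l 1 \<in> integer_lattice"
    by (intro integer_lattice_add integer_lattice_scale) auto
  ultimately show "axis i 1 + of_int n *\<^sub>R axis l 1 \<in> row_lattice U \<longleftrightarrow>
      int q dvd (if i = l then n + 1 else n - U $ i $ l)"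
    using real_eq_of_nat_mult_iff by (simp only: mem_row_lattice[OF U] simp_thms)
  have "hermite_functional U l (of_int n *\<^sub>R axis l 1) = of_int n"
    by (simp add: hermite_functional_scale hermite_functional_axis)
  moreover have "of_int n *\<^sub>R axis l 1 \<in> integer_lattice"
    by (intro integer_lattice_scale) auto
  ultimately show "of_int n *\<^sub>R axis l 1 \<in> row_lattice U \<longleftrightarrow> int q dvd n"
    using real_eq_of_nat_mult_iff by (simp only: mem_row_lattice[OF U] simp_thms)
qed

text \<open>Since the functional is 1 on \<open>axis l 1\<close>, subtracting its value modulo
  \<open>q\<close> leaves a multiple of \<open>q\<close>. Uniqueness of the residue is the second
  part of \<open>axis_mem_row_lattice\<close>.\<close>

lemma row_lattice_residue:
  assumes q: "prime q" and U: "prime_hermite q l U" and y: "y \<in> integer_lattice"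
  obtains b :: int where "b \<in> {0..int q - 1}" "y - of_int b *\<^sub>R axis l 1 \<in> row_lattice U"
proof -
  obtain n :: int where n: "hermite_functional U l y = n"
    using hermite_functional_Ints[OF y] by (metis Ints_cases)
  have q0: "int q > 0" using q prime_gt_0_nat by simp
  have "int q dvd n - n mod int q" by (simp add: dvd_minus_mod)
  moreover have "hermite_functional U l (y - of_int (n mod int q) *\<^sub>R axis l 1) = of_int (n - n mod int q)"
    by (simp add: hermite_functional_diff hermite_functional_scale hermite_functional_axis n)
  moreover have "y - of_int (n mod int q) *\<^sub>R axis l 1 \<in> integer_lattice"
    by (intro integer_lattice_diff integer_lattice_scale y) auto
  ultimately have "y - of_int (n mod int q) *\<^sub>R axis l 1 \<in> row_lattice U"
    using real_eq_of_nat_mult_iff by (simp only: mem_row_lattice[OF U] simp_thms)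
  moreover have "n mod int q \<in> {0..int q - 1}" using q0 by simp
  ultimately show ?thesis using that by blast
qed

text \<open>The quotient is cyclic of order \<open>q\<close>, generated by \<open>axis l 1\<close>.
  A strictly larger subgroup contains a multiple of this vector by some \<open>b\<close> prime to
  \<open>q\<close>, hence by Bezout the vector itself, hence everything.\<close>

lemma maximal_row_lattice:
  assumes q: "prime q" and U: "prime_hermite q l U"
  shows "maximal_lattice_subgroup (row_lattice U)"
proof -
  note sg = lattice_subgroup_row_lattice[OF U]
  have q1: "int q > 1" using prime_gt_1_nat[OF q] by simp
  have "axis l 1 \<notin> row_lattice U"
    using axis_mem_row_lattice(2)[OF U, of 1] q1 by simp
  then have ne: "row_lattice U \<noteq> integer_lattice" by (metis axis_mem_integer_lattice)
  have "L = integer_lattice" if L: "lattice_subgroup L" and s: "row_lattice U \<subset> L" for L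
  proof -
    obtain y where y: "y \<in> L" "y \<notin> row_lattice U" using s by blast
    have yi: "y \<in> integer_lattice" using y L unfolding lattice_subgroup_def by blast
    obtain b where b: "y - of_int b *\<^sub>R axis l 1 \<in> row_lattice U"
      using row_lattice_residue[OF q U yi] by blast
    then have "y - (y - of_int b *\<^sub>R axis l 1) \<in> L"
      using lattice_subgroup_diff[OF L y(1)] s by blast
    then have bL: "of_int b *\<^sub>R axis l 1 \<in> L" by simp
    have "\<not> int q dvd b"
    proof
      assume "int q dvd b"
      then have m: "of_int b *\<^sub>R axis l 1 \<in> row_lattice U" using axis_mem_row_lattice(2)[OF U] by blast
      show False using lattice_subgroup_add[OF sg b m] y by simp
    qed
    then have "coprime (int q) b" using q by (simp add: prime_imp_coprime)
    then obtain u v where uv: "u * int q + v * b = 1" by (metis bezout_int coprime_iff_gcd_eq_1)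
    have "of_int (int q) *\<^sub>R axis l 1 \<in> L"
      using axis_mem_row_lattice(2)[OF U, of "int q"] s by auto
    then have "of_int u *\<^sub>R of_int (int q) *\<^sub>R axis l 1 + of_int v *\<^sub>R of_int b *\<^sub>R axis l 1 \<in> L"
      using lattice_subgroup_add[OF L lattice_subgroup_scale[OF L] lattice_subgroup_scale[OF L bL]] by blast
    then have "of_int (u * int q + v * b) *\<^sub>R axis l 1 \<in> L" by (simp add: algebra_simps)
    then have eL: "axis l 1 \<in> L" using uv by simp
    have "z \<in> L" if z: "z \<in> integer_lattice" for z
    proof -
      obtain c where c: "z - of_int c *\<^sub>R axis l 1 \<in> row_lattice U"
        using row_lattice_residue[OF q U z] by blast
      then have "(z - of_int c *\<^sub>R axis l 1) + of_int c *\<^sub>R axis l 1 \<in> L"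
        using lattice_subgroup_add[OF L _ lattice_subgroup_scale[OF L eL]] s by blast
      then show ?thesis by simp
    qed
    then show ?thesis using L unfolding lattice_subgroup_def by blast
  qed
  then show ?thesis using sg ne unfolding maximal_lattice_subgroup_def by blast
qed

text \<open>The lattice determines all data: \<open>l\<close> is the last index whose unit vector is
  missing, \<open>q\<close> is read off from the multiples of \<open>axis l 1\<close>, and column
  \<open>l\<close> consists of reduced residues modulo \<open>q\<close>.\<close>

lemma row_lattice_inject:
  fixes U U' :: "int^'k::{finite,wellorder}^'k::{finite,wellorder}"
  assumes q: "prime q" and U: "prime_hermite q l U"
    and q': "prime q'" and U': "prime_hermite q' l' U'"
    and eq: "row_lattice U = row_lattice U'"
  shows "q = q' \<and> l = l' \<and> U = U'"
proof -
  \<comment> \<open>Below the diagonal column \<open>l1\<close> is zero, so every unit vector after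
    \<open>l1\<close> lies in the first lattice, whereas \<open>axis l2 1\<close> is missing from
    the second.\<close>
  have le: "l2 \<le> l1" if "prime q2" "prime_hermite q1 l1 U1" "prime_hermite q2 l2 U2" "row_lattice U1 = row_lattice U2"
    for q1 l1 q2 l2 and U1 U2 :: "((int, 'k) vec, 'k) vec"
  proof (rule ccontr)
    assume "\<not> l2 \<le> l1"
    then have "axis l2 1 \<in> row_lattice U1"
      using axis_mem_row_lattice(1)[OF that(2), of l2 0] that(2) by (auto simp: prime_hermite_def)
    then show False
      using axis_mem_row_lattice(2)[OF that(3), of 1] that(4) prime_gt_1_nat[OF that(1)] by simp
  qed
  have l: "l = l'" using le[OF q' U U' eq] le[OF q U' U eq[symmetric]] by simp
  have "int q dvd n \<longleftrightarrow> int q' dvd n" for n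
    using axis_mem_row_lattice(2)[OF U] axis_mem_row_lattice(2)[OF U'] eq l by simp
  from this[of "int q"] this[of "int q'"] have qq: "q = q'" by (simp add: dvd_antisym)
  have col: "U $ i $ l = U' $ i $ l" if "i < l" for i
  proof -
    have ne: "i \<noteq> l" using that by simp
    have "axis i 1 + of_int (U $ i $ l) *\<^sub>R axis l 1 \<in> row_lattice U'"
      using axis_mem_row_lattice(1)[OF U, of i "U $ i $ l"] ne eq by simp
    then have "int q dvd U $ i $ l - U' $ i $ l"
      using axis_mem_row_lattice(1)[OF U', of i "U $ i $ l"] l qq ne by simp
    moreover have "0 \<le> U $ i $ l" "U $ i $ l < int q" "0 \<le> U' $ i $ l" "U' $ i $ l < int q"
      using U U' that l qq unfolding prime_hermite_def by auto
    ultimately show ?thesis by (metis mod_eq_dvd_iff mod_pos_pos_trivial)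
  qed
  have "U $ i $ j = U' $ i $ j" for i j
  proof (cases "i \<noteq> l \<and> j = l")
    case True
    then show ?thesis using U U' l col[of i] unfolding prime_hermite_def by (cases i l rule: linorder_cases) auto
  next
    case False
    then show ?thesis using U U' l qq unfolding prime_hermite_def
      by (cases "i = l"; cases "j = l"; cases "i = j") auto
  qed
  then show ?thesis using l qq by (simp add: vec_eq_iff)
qed

section \<open>Every maximal subgroup is a row lattice\<close>

lemma maximal_lattice_subgroup_generate:
  assumes L: "maximal_lattice_subgroup L" and x: "x \<in> integer_lattice" "x \<notin> L" and z: "z \<in> integer_lattice"
  obtains n :: int where "z - of_int n *\<^sub>R x \<in> L"
proof -
  have sg: "lattice_subgroup L" using L unfolding maximal_lattice_subgroup_def by blast
  \<comment> \<open>This is the subgroup generated by \<open>L\<close> and \<open>x\<close>; it is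
    strictly larger than \<open>L\<close>, so maximality makes it the full lattice.\<close>
  define L' where "L' = {z \<in> integer_lattice. \<exists>n::int. z - of_int n *\<^sub>R x \<in> L}"
  have "u - v \<in> L'" if uv: "u \<in> L'" "v \<in> L'" for u v
  proof -
    obtain m n :: int where mn: "u - of_int m *\<^sub>R x \<in> L" "v - of_int n *\<^sub>R x \<in> L"
      using uv unfolding L'_def by blast
    have "u - v - of_int (m - n) *\<^sub>R x = (u - of_int m *\<^sub>R x) - (v - of_int n *\<^sub>R x)"
      by (simp add: algebra_simps)
    also have "\<dots> \<in> L" using lattice_subgroup_diff[OF sg] mn by blast
    finally show ?thesis using uv integer_lattice_diff unfolding L'_def by blast
  qed
  moreover have LL: "L \<subseteq> L'"
    using sg unfolding L'_def lattice_subgroup_def by (auto intro!: exI[of _ 0])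
  ultimately have "lattice_subgroup L'" using sg unfolding lattice_subgroup_def L'_def by blast
  moreover have "x \<in> L'"
    using x sg unfolding L'_def lattice_subgroup_def by (auto intro!: exI[of _ 1])
  ultimately have "L' = integer_lattice"
    using L LL x unfolding maximal_lattice_subgroup_def by blast
  then show ?thesis using z that unfolding L'_def by blast
qed

lemma integer_lattice_axis_expansion: "y = (\<Sum>i\<in>UNIV. y $ i *\<^sub>R axis i 1)" for y :: "real^'k"
  using basis_expansion[of y] by (simp add: scalar_mult_eq_scaleR)

text \<open>A proper subgroup misses some unit vector. Taking the last one matters: the later unit
  vectors lie in \<open>L\<close>, which gives the zeros below the pivot in column
  \<open>l\<close>.\<close>

lemma maximal_lattice_subgroup_axis:
  fixes L :: "(real^'k::{finite,wellorder}) set"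
  assumes L: "maximal_lattice_subgroup L"
  obtains l where "axis l 1 \<notin> L" "\<And>i. i > l \<Longrightarrow> axis i 1 \<in> L"
proof -
  have sg: "lattice_subgroup L" using L unfolding maximal_lattice_subgroup_def by blast
  let ?N = "{i. axis i 1 \<notin> L}"
  have "?N \<noteq> {}"
  proof
    assume "?N = {}"
    then have ax: "axis i 1 \<in> L" for i by blast
    have "y \<in> L" if y: "y \<in> integer_lattice" for y
    proof -
      have "(\<Sum>i\<in>UNIV. y $ i *\<^sub>R axis i 1) \<in> L"
      proof (rule lattice_subgroup_sum[OF sg])
        fix i :: 'k
        obtain n :: int where "y $ i = n" using y unfolding integer_lattice_def by (auto elim: Ints_cases)
        then show "y $ i *\<^sub>R axis i 1 \<in> L" using lattice_subgroup_scale[OF sg ax] by simp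
      qed
      then show ?thesis using integer_lattice_axis_expansion[of y] by simp
    qed
    then have "L = integer_lattice" using sg by (auto simp: lattice_subgroup_def)
    then show False using L by (simp add: maximal_lattice_subgroup_def)
  qed
  then have "Max ?N \<in> ?N" by (intro Max_in) auto
  moreover have "axis i 1 \<in> L" if "i > Max ?N" for i
    using that Max_ge[of ?N i] by (auto simp: not_le[symmetric])
  ultimately show ?thesis using that by blast
qed

text \<open>The quotient by a maximal subgroup is generated by each of its nonzero elements. Such a
  group is finite of prime order, and \<open>q\<close> is the order of the class of
  \<open>e\<close>.\<close>

lemma maximal_lattice_subgroup_prime:
  assumes L: "maximal_lattice_subgroup L" and e: "e \<in> integer_lattice" "e \<notin> L"
  obtains q where "prime q" "\<And>n. of_int n *\<^sub>R e \<in> L \<longleftrightarrow> int q dvd n"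
proof -
  have sg: "lattice_subgroup L" using L unfolding maximal_lattice_subgroup_def by blast
  note scale = lattice_subgroup_scale[OF sg]
  \<comment> \<open>For finite order, suppose that twice \<open>e\<close> is not in
    \<open>L\<close>. Then it generates modulo \<open>L\<close>, so \<open>e\<close> is congruent to
    \<open>2 * n\<close> times itself, and the odd, hence nonzero, number \<open>1 - 2 * n\<close>
    annihilates it.\<close>
  have ex: "\<exists>n::nat. n > 0 \<and> of_nat n *\<^sub>R e \<in> L"
  proof (cases "of_int 2 *\<^sub>R e \<in> L")
    case True
    then show ?thesis by (intro exI[of _ 2]) simp
  next
    case False
    then obtain n :: int where "e - of_int n *\<^sub>R of_int 2 *\<^sub>R e \<in> L"
      using maximal_lattice_subgroup_generate[OF L _ _ e(1), of "of_int 2 *\<^sub>R e"]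
        integer_lattice_scale[OF e(1)] by blast
    then have m: "of_int (1 - 2 * n) *\<^sub>R e \<in> L" by (simp add: algebra_simps)
    have "of_int \<bar>1 - 2 * n\<bar> *\<^sub>R e \<in> L"
    proof (cases "1 - 2 * n \<ge> 0")
      case True
      then show ?thesis using m by (simp only: abs_of_nonneg)
    next
      case False
      then have "\<bar>1 - 2 * n\<bar> = - (1 - 2 * n)" by simp
      then show ?thesis using lattice_subgroup_uminus[OF sg m] by (simp only: of_int_minus scaleR_minus_left)
    qed
    moreover have "1 - 2 * n \<noteq> 0" by presburger
    then have "nat \<bar>1 - 2 * n\<bar> > 0" by simp
    ultimately show ?thesis by (intro exI[of _ "nat \<bar>1 - 2 * n\<bar>"]) simp
  qed
  define q where "q = (LEAST n::nat. n > 0 \<and> of_nat n *\<^sub>R e \<in> L)"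
  have q: "q > 0" "of_nat q *\<^sub>R e \<in> L" using LeastI_ex[OF ex] unfolding q_def by auto
  have least: "\<not> (n > 0 \<and> of_nat n *\<^sub>R e \<in> L)" if "n < q" for n
    using not_less_Least[OF that[unfolded q_def]] .
  have iff: "of_int n *\<^sub>R e \<in> L \<longleftrightarrow> int q dvd n" for n
  proof
    assume n: "of_int n *\<^sub>R e \<in> L"
    define r where "r = nat (n mod int q)"
    have r: "int r = n mod int q" "r < q" using q(1) by (auto simp: r_def nat_less_iff)
    have "of_int n *\<^sub>R e - of_int (n div int q) *\<^sub>R (of_nat q *\<^sub>R e) \<in> L"
      by (intro lattice_subgroup_diff[OF sg] n scale q)
    also have "of_int n *\<^sub>R e - of_int (n div int q) *\<^sub>R (of_nat q *\<^sub>R e) = of_int (n mod int q) *\<^sub>R e"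
      by (simp add: minus_div_mult_eq_mod[symmetric] algebra_simps)
    also have "real_of_int (n mod int q) = of_nat r" by (simp flip: r(1))
    finally have "r = 0" using least[OF r(2)] by simp
    then show "int q dvd n" using r(1) by (simp add: dvd_eq_mod_eq_0)
  next
    assume "int q dvd n"
    then obtain m where "n = int q * m" by auto
    then show "of_int n *\<^sub>R e \<in> L" using scale[OF q(2), of m] by (simp add: mult.commute)
  qed
  have "q \<noteq> 1" using q(2) e(2) by auto
  \<comment> \<open>For a proper divisor \<open>m\<close> the multiple of \<open>e\<close> by
    \<open>m\<close> generates modulo \<open>L\<close>. Expressing \<open>e\<close> through it shows
    that \<open>q\<close>, and hence \<open>m\<close>, divides \<open>1 - n * m\<close>, so
    \<open>m\<close> divides 1.\<close>
  moreover have "m = 1" if m: "m dvd q" "m \<noteq> q" for m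
  proof -
    have "\<not> q dvd m" using m by (meson dvd_antisym)
    then have "of_int (int m) *\<^sub>R e \<notin> L" using iff[of "int m"] by simp
    then obtain n :: int where "e - of_int n *\<^sub>R of_int (int m) *\<^sub>R e \<in> L"
      using maximal_lattice_subgroup_generate[OF L _ _ e(1)] integer_lattice_scale[OF e(1)] by blast
    then have "of_int (1 - n * int m) *\<^sub>R e \<in> L" by (simp add: algebra_simps)
    then have "int q dvd 1 - n * int m" using iff by blast
    then have "int m dvd 1 - n * int m" using m(1) by (meson dvd_trans int_dvd_int_iff)
    then have "int m dvd 1" by (metis diff_add_cancel dvd_add dvd_triv_right)
    then show ?thesis by simp
  qed
  ultimately have "prime q" using q(1) by (auto simp: prime_nat_iff)
  then show ?thesis using that iff by blast
qed

lemma maximal_lattice_subgroup_is_row_lattice: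
  fixes L :: "(real^'k::{finite,wellorder}) set"
  assumes L: "maximal_lattice_subgroup L"
  obtains q l and U :: "((int, 'k) vec, 'k) vec" where "prime q" "prime_hermite q l U" "L = row_lattice U"
proof -
  have sg: "lattice_subgroup L" using L unfolding maximal_lattice_subgroup_def by blast
  obtain l where l: "axis l 1 \<notin> L" "\<And>i. i > l \<Longrightarrow> axis i 1 \<in> L"
    using maximal_lattice_subgroup_axis[OF L] by blast
  define e where "e = (axis l 1 :: (real, 'k) vec)"
  have e: "e \<in> integer_lattice" "e \<notin> L" using l by (auto simp: e_def)
  obtain q where q: "prime q" and iff: "\<And>n. of_int n *\<^sub>R e \<in> L \<longleftrightarrow> int q dvd n"
    using maximal_lattice_subgroup_prime[OF L e] by blast
  have q0: "int q > 0" using q prime_gt_0_nat by simp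
  have "\<exists>c::int. 0 \<le> c \<and> c < int q \<and> axis i 1 + of_int c *\<^sub>R e \<in> L" for i :: 'k
  proof -
    obtain n :: int where n: "axis i 1 - of_int n *\<^sub>R e \<in> L"
      using maximal_lattice_subgroup_generate[OF L e axis_mem_integer_lattice] by blast
    \<comment> \<open>The sign changes because the matrix rows are to be \<open>axis i 1\<close>
      plus, not minus, a multiple of \<open>e\<close>.\<close>
    let ?c = "(- n) mod int q"
    have "int q dvd n + ?c" by (metis add.right_inverse dvd_0_right dvd_eq_mod_eq_0 mod_0 mod_add_right_eq)
    then have "(axis i 1 - of_int n *\<^sub>R e) + of_int (n + ?c) *\<^sub>R e \<in> L"
      using lattice_subgroup_add[OF sg n] iff by blast
    then have "axis i 1 + of_int ?c *\<^sub>R e \<in> L" by (simp add: algebra_simps)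
    then show ?thesis using q0 by (intro exI[of _ ?c]) auto
  qed
  then obtain c :: "'k \<Rightarrow> int" where c: "\<And>i. 0 \<le> c i \<and> c i < int q \<and> axis i 1 + of_int (c i) *\<^sub>R e \<in> L"
    by metis
  \<comment> \<open>The residues \<open>c i\<close> enter only above the pivot; for
    \<open>i > l\<close> the entry 0 is correct because \<open>axis i 1\<close> itself is in
    \<open>L\<close>.\<close>
  define U :: "((int, 'k) vec, 'k) vec" where "U = (\<chi> i j. if i = l then (if j = l then int q else 0)
      else if j = i then 1 else if j = l \<and> i < l then c i else 0)"
  have U: "prime_hermite q l U" unfolding prime_hermite_def U_def using c by auto
  have Uax: "axis i 1 + of_int (U $ i $ l) *\<^sub>R e \<in> L" if "i \<noteq> l" for i
    using that c l(2)[of i] by (cases "i < l") (auto simp: U_def)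
  \<comment> \<open>The difference is a combination of the rows other than \<open>l\<close>, all in
    \<open>L\<close>. Membership of \<open>y\<close> in \<open>L\<close> thus depends only on
    whether \<open>q\<close> divides the functional.\<close>
  have red: "y - hermite_functional U l y *\<^sub>R e \<in> L" if y: "y \<in> integer_lattice" for y
  proof -
    have "y = y $ l *\<^sub>R e + (\<Sum>i\<in>UNIV - {l}. y $ i *\<^sub>R axis i 1)"
      using integer_lattice_axis_expansion[of y] by (simp add: sum.remove[of UNIV l] e_def)
    then have "y - hermite_functional U l y *\<^sub>R e =
        (\<Sum>i\<in>UNIV - {l}. y $ i *\<^sub>R axis i 1) + (\<Sum>i\<in>UNIV - {l}. of_int (U $ i $ l) * y $ i) *\<^sub>R e"
      by (simp add: hermite_functional_def algebra_simps)
    also have "\<dots> = (\<Sum>i\<in>UNIV - {l}. y $ i *\<^sub>R (axis i 1 + of_int (U $ i $ l) *\<^sub>R e))"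
      by (simp add: scaleR_sum_left sum.distrib[symmetric] algebra_simps)
    also have "\<dots> \<in> L"
    proof (rule lattice_subgroup_sum[OF sg])
      fix i assume i: "i \<in> UNIV - {l}"
      obtain n :: int where "y $ i = n" using y unfolding integer_lattice_def by (auto elim: Ints_cases)
      then show "y $ i *\<^sub>R (axis i 1 + of_int (U $ i $ l) *\<^sub>R e) \<in> L"
        using lattice_subgroup_scale[OF sg Uax, of i n] i by simp
    qed
    finally show ?thesis .
  qed
  have "y \<in> L \<longleftrightarrow> y \<in> row_lattice U" for y
  proof (cases "y \<in> integer_lattice")
    case True
    obtain n :: int where n: "hermite_functional U l y = n"
      using hermite_functional_Ints[OF True] by (metis Ints_cases)
    have d: "y - of_int n *\<^sub>R e \<in> L" using red[OF True] n by simp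
    have "y \<in> L \<longleftrightarrow> of_int n *\<^sub>R e \<in> L"
      using lattice_subgroup_diff[OF sg _ d, of y] lattice_subgroup_add[OF sg d, of "of_int n *\<^sub>R e"] by auto
    then show ?thesis using iff True n real_eq_of_nat_mult_iff by (simp add: mem_row_lattice[OF U])
  next
    case False
    then show ?thesis using sg mem_row_lattice[OF U] unfolding lattice_subgroup_def by blast
  qed
  then show ?thesis using that q U by blast
qed

section \<open>The correspondence\<close>

lemma linear_linear_extension:
  assumes "fundamental_system R \<Delta>"
  shows "linear (linear_extension \<Delta> b)"
proof (rule linearI)
  have ind: "independent \<Delta>" and sp: "x \<in> span \<Delta>" for x
    using assms unfolding fundamental_system_def by auto
  show "linear_extension \<Delta> b (x + y) = linear_extension \<Delta> b x + linear_extension \<Delta> b y" for x y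
    by (simp add: linear_extension_def representation_add[OF ind sp sp] algebra_simps sum.distrib)
  show "linear_extension \<Delta> b (r *\<^sub>R x) = r *\<^sub>R linear_extension \<Delta> b x" for r x
    by (simp add: linear_extension_def representation_scale[OF ind sp] sum_distrib_left mult.assoc)
qed

lemma linear_extension_simple:
  assumes \<Delta>: "fundamental_system R \<Delta>" and "\<delta> \<in> \<Delta>"
  shows "linear_extension \<Delta> b \<delta> = of_int (b \<delta>)"
proof -
  have "independent \<Delta>" using \<Delta> unfolding fundamental_system_def by blast
  then have "linear_extension \<Delta> b \<delta> = (\<Sum>\<gamma>\<in>\<Delta>. if \<gamma> = \<delta> then of_int (b \<delta>) else 0)"
    unfolding linear_extension_def using \<open>\<delta> \<in> \<Delta>\<close>
    by (intro sum.cong) (simp_all add: representation_basis)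
  then show ?thesis
    using fundamental_system_finite[OF \<Delta>] \<open>\<delta> \<in> \<Delta>\<close> by simp
qed

lemma associated_system_eq_coset_system:
  assumes "prime q" "prime_hermite q l U"
  shows "associated_system R \<Delta> (q, b, U) =
    coset_system R (\<lambda>\<alpha>. linear_extension \<Delta> b \<alpha> *\<^sub>R axis l 1) (row_lattice U)"
proof -
  have "(THE i. scaled_row q U i) = l"
    using prime_hermite_scaled_row[OF assms] by (intro the_equality) auto
  then show ?thesis by (simp only: associated_system_def coset_system_def prod.case)
qed

text \<open>The first conjunct ensures that the index described in \<open>associated_system\<close>
  exists and is unique; the second is the correspondence.\<close>

theorem mainTheorem8:
  fixes R \<Delta> :: "'a::euclidean_space set"
  assumes "finite_root_system R" and "reduced_root_system R" and "irreducible_root_system R"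
    and "DIM('a) \<ge> 2"
    and "fundamental_system R \<Delta>"
  shows "(\<forall>q. \<forall>U :: int^'k::{finite,wellorder}^'k::{finite,wellorder}.
            prime q \<and> U \<in> hermite_matrices q \<longrightarrow> (\<exists>!l. scaled_row q U l)) \<and>
         bij_betw (associated_system R \<Delta>)
           (triples \<Delta> :: (nat \<times> ('a \<Rightarrow> int) \<times> (int^'k::{finite,wellorder}^'k::{finite,wellorder})) set)
           {\<Psi> :: ('a \<times> (real^'k::{finite,wellorder})) set. maximal_closed_subroot_system R \<Psi> \<and> gradient R \<Psi> = R}"
proof (intro conjI allI impI)
  fix q and U :: "((int, 'k) vec, 'k) vec"
  assume "prime q \<and> U \<in> hermite_matrices q"
  then show "\<exists>!l. scaled_row q U l"
    using hermite_matrices_imp_prime_hermite prime_hermite_scaled_row by metis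
next
  note R = assms(1,3,4,5)
  note \<Delta> = assms(5)
  have ne: "R \<noteq> {}" using assms(3) unfolding irreducible_root_system_def by blast
  define P where "P b l \<alpha> = linear_extension \<Delta> b \<alpha> *\<^sub>R (axis l 1 :: (real, 'k) vec)" for b l \<alpha>
  have P: "linear (P b l)" for b l
    unfolding P_def using linear_linear_extension[OF \<Delta>]
    by (intro linearI) (auto simp: linear_add linear_scale algebra_simps)
  have P\<Delta>: "P b l \<delta> = of_int (b \<delta>) *\<^sub>R axis l 1" if "\<delta> \<in> \<Delta>" for b l \<delta>
    using linear_extension_simple[OF \<Delta> that] by (simp add: P_def)
  have int: "P b l \<delta> \<in> integer_lattice" if "\<delta> \<in> \<Delta>" for b l \<delta>
    by (simp add: P\<Delta>[OF that] integer_lattice_scale)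
  have assoc: "associated_system R \<Delta> (q, b, U) = coset_system R (P b l) (row_lattice U)"
    if "prime q" "prime_hermite q l U" for q l b U
    using associated_system_eq_coset_system[OF that] unfolding P_def by blast
  show "bij_betw (associated_system R \<Delta>)
      (triples \<Delta> :: (nat \<times> ('a \<Rightarrow> int) \<times> ((int, 'k) vec, 'k) vec) set)
      {\<Psi> :: ('a \<times> (real, 'k) vec) set. maximal_closed_subroot_system R \<Psi> \<and> gradient R \<Psi> = R}"
    unfolding bij_betw_def
  proof (intro conjI equalityI subsetI inj_onI)
    fix t t' :: "nat \<times> ('a \<Rightarrow> int) \<times> (((int, 'k) vec, 'k) vec)"
    assume t: "t \<in> triples \<Delta>" "t' \<in> triples \<Delta>" "associated_system R \<Delta> t = associated_system R \<Delta> t'"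
    obtain q b U q' b' U' where [simp]: "t = (q, b, U)" "t' = (q', b', U')" by (metis surj_pair)
    have q: "prime q" "prime q'" and b: "b \<in> \<Delta> \<rightarrow>\<^sub>E {0..int q - 1}" "b' \<in> \<Delta> \<rightarrow>\<^sub>E {0..int q' - 1}"
      and "U \<in> hermite_matrices q" "U' \<in> hermite_matrices q'"
      using t unfolding triples_def by auto
    then obtain l l' where U: "prime_hermite q l U" "prime_hermite q' l' U'"
      by (metis hermite_matrices_imp_prime_hermite)
    have eq: "coset_system R (P b l) (row_lattice U) = coset_system R (P b' l') (row_lattice U')"
      using t(3) assoc q U by simp
    \<comment> \<open>For injectivity, the subgroup is compared first and yields \<open>q\<close>,
      \<open>l\<close> and \<open>U\<close>; the base points over \<open>\<Delta>\<close>, compared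
      modulo it, then yield \<open>b\<close>.\<close>
    have LL: "row_lattice U = row_lattice U'"
      by (rule coset_system_inject[OF _ _ ne eq]) (use U lattice_subgroup_row_lattice in blast)+
    then have qlU: "q = q'" "l = l'" "U = U'"
      using row_lattice_inject[OF q(1) U(1) q(2) U(2)] by auto
    have "b = b'"
    proof (rule PiE_ext[OF b(1)])
      show "b' \<in> \<Delta> \<rightarrow>\<^sub>E {0..int q - 1}" using b(2) qlU by simp
      fix \<delta> assume \<delta>: "\<delta> \<in> \<Delta>"
      have "0 \<in> row_lattice U"
        using lattice_subgroup_row_lattice[OF U(1)] unfolding lattice_subgroup_def by blast
      then have "(\<delta>, P b l \<delta>) \<in> coset_system R (P b' l') (row_lattice U')"
        using \<delta> \<Delta> unfolding eq[symmetric] by (auto simp: mem_coset_system fundamental_system_def)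
      then have "of_int (b \<delta> - b' \<delta>) *\<^sub>R axis l 1 \<in> row_lattice U"
        using qlU \<delta> by (simp add: mem_coset_system P\<Delta> algebra_simps)
      then have "int q dvd b \<delta> - b' \<delta>" using axis_mem_row_lattice(2)[OF U(1)] by blast
      moreover have "b \<delta> \<in> {0..int q - 1}" "b' \<delta> \<in> {0..int q - 1}" using b \<delta> qlU by auto
      ultimately show "b \<delta> = b' \<delta>"
        by (metis atLeastAtMost_iff mod_eq_dvd_iff mod_pos_pos_trivial zle_diff1_eq)
    qed
    then show "t = t'" using qlU by simp
  next
    fix \<Psi> :: "('a \<times> (real, 'k) vec) set"
    assume "\<Psi> \<in> associated_system R \<Delta> ` triples \<Delta>"
    then obtain q b and U :: "((int, 'k) vec, 'k) vec" where q: "prime q" and U: "U \<in> hermite_matrices q"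
      and \<Psi>: "\<Psi> = associated_system R \<Delta> (q, b, U)"
      unfolding triples_def by auto
    obtain l where l: "prime_hermite q l U" using hermite_matrices_imp_prime_hermite[OF q U] by blast
    have eq: "\<Psi> = coset_system R (P b l) (row_lattice U)" using \<Psi> assoc[OF q l] by simp
    have m: "maximal_lattice_subgroup (row_lattice U)" by (rule maximal_row_lattice[OF q l])
    then have sg: "lattice_subgroup (row_lattice U)" "row_lattice U \<noteq> integer_lattice"
      unfolding maximal_lattice_subgroup_def by auto
    show "\<Psi> \<in> {\<Psi>. maximal_closed_subroot_system R \<Psi> \<and> gradient R \<Psi> = R}"
      using maximal_coset_system_iff[OF R P int sg] gradient_coset_system[OF sg(1)] m unfolding eq by simp
  next
    fix \<Psi> :: "('a \<times> (real, 'k) vec) set"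
    assume "\<Psi> \<in> {\<Psi>. maximal_closed_subroot_system R \<Psi> \<and> gradient R \<Psi> = R}"
    then have max: "maximal_closed_subroot_system R \<Psi>" and grad: "gradient R \<Psi> = R" by auto
    have clos: "closed_subroot_system R \<Psi>" using max unfolding maximal_closed_subroot_system_def by blast
    \<comment> \<open>Surjectivity starts from the full gradient, which supplies a point over each
      simple root; \<open>g\<close> extends this choice linearly and need not take values on a
      coordinate axis.\<close>
    have "\<exists>y. (\<delta>, y) \<in> \<Psi>" if "\<delta> \<in> \<Delta>" for \<delta>
      using that \<Delta> grad unfolding gradient_def fundamental_system_def by blast
    then obtain p where p: "\<And>\<delta>. \<delta> \<in> \<Delta> \<Longrightarrow> (\<delta>, p \<delta>) \<in> \<Psi>" by metis
    have "independent \<Delta>" using \<Delta> unfolding fundamental_system_def by blast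
    then obtain g where g: "linear g" "\<forall>\<delta>\<in>\<Delta>. g \<delta> = p \<delta>"
      using linear_independent_extend by blast
    have g\<Psi>: "(\<delta>, g \<delta>) \<in> \<Psi>" if "\<delta> \<in> \<Delta>" for \<delta> using g(2) p that by simp
    then obtain L where L: "lattice_subgroup L" "L \<noteq> integer_lattice" "\<Psi> = coset_system R g L"
      using closed_subroot_is_coset_system[OF R clos g(1)] by blast
    have gint: "g \<delta> \<in> integer_lattice" if "\<delta> \<in> \<Delta>" for \<delta>
      using g\<Psi>[OF that] clos unfolding closed_subroot_system_def subroot_system_def real_roots_def by blast
    have "maximal_lattice_subgroup L"
      using maximal_coset_system_iff[OF R g(1) gint L(1,2)] max L(3) by simp
    then obtain q l and U :: "((int, 'k) vec, 'k) vec" where q: "prime q" and U: "prime_hermite q l U" and LU: "L = row_lattice U"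
      using maximal_lattice_subgroup_is_row_lattice by blast
    have "\<exists>b::int. b \<in> {0..int q - 1} \<and> g \<delta> - of_int b *\<^sub>R axis l 1 \<in> L" if "\<delta> \<in> \<Delta>" for \<delta>
      using row_lattice_residue[OF q U gint[OF that]] LU by blast
    then obtain b' :: "'a \<Rightarrow> int" where b': "\<And>\<delta>. \<delta> \<in> \<Delta> \<Longrightarrow> b' \<delta> \<in> {0..int q - 1} \<and> g \<delta> - of_int (b' \<delta>) *\<^sub>R axis l 1 \<in> L"
      by metis
    \<comment> \<open>Tuples are extensional functions, so the values outside
      \<open>\<Delta>\<close> have to be the default \<open>undefined\<close>.\<close>
    define b where "b = restrict b' \<Delta>"
    have b: "b \<in> \<Delta> \<rightarrow>\<^sub>E {0..int q - 1}" using b' by (auto simp: b_def)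
    \<comment> \<open>The reduced base points still lie in \<open>\<Psi>\<close>, so the structure
      result applies again with \<open>P b l\<close> in place of \<open>g\<close>. Invariance of the
      subgroup identifies \<open>L'\<close> with \<open>L\<close>, without comparing
      \<open>g\<close> and \<open>P b l\<close> on the remaining roots.\<close>
    have "(\<delta>, P b l \<delta>) \<in> \<Psi>" if \<delta>: "\<delta> \<in> \<Delta>" for \<delta>
    proof -
      have "- (g \<delta> - of_int (b' \<delta>) *\<^sub>R axis l 1) \<in> L"
        using lattice_subgroup_uminus[OF L(1)] b' \<delta> by blast
      then show ?thesis
        using \<delta> \<Delta> by (auto simp: L(3) mem_coset_system P\<Delta> b_def fundamental_system_def)
    qed
    then obtain L' where L': "lattice_subgroup L'" "\<Psi> = coset_system R (P b l) L'"
      using closed_subroot_is_coset_system[OF R clos P] by blast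
    then have "L = L'" using coset_system_inject[OF L(1) L'(1) ne] L(3) by simp
    then have "\<Psi> = associated_system R \<Delta> (q, b, U)" using assoc[OF q U] LU L'(2) by simp
    moreover have "(q, b, U) \<in> triples \<Delta>"
      using q b prime_hermite_imp_hermite_matrices[OF q U] unfolding triples_def by blast
    ultimately show "\<Psi> \<in> associated_system R \<Delta> ` triples \<Delta>" by blast
  qed
qed

end
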